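(* Let $k\ge 2$, let $\lambda$ be a partition with empty $k$-core, let $p:=|\lambda|/k$, let $\mu$ be a partition of $p$, and let $T\in\mathrm{RHT}^{\lambda}_{k\mu}$ with $\omega^{\lambda}_{k\mu}(T)=(T_1,\ldots,T_k)$. Let $T'$ be any rim hook tableau of shape $\lambda$ and type $(k^p)=(k,k,\ldots,k)$ ($p$ parts); such $T'$ exist. Then $$\operatorname{sign}(\pi_T)=\operatorname{sign}(\pi_{T'})\cdot\operatorname{sign}(\pi_{T_1})\cdots\operatorname{sign}(\pi_{T_k}).$$
   Context: Partitions $\lambda=(\lambda_1\ge\lambda_2\ge\cdots\ge 0)$ have finitely many nonzero parts; $\ell(\lambda)$ is the number of nonzero parts. The 0/1 sequence of $\lambda$ is $s(\lambda)=(s_j)_{j\in\mathbb Z}$ with $s_j=0$ if $j\in\{\lambda_i-i+1: i\ge 1\}$ and $s_j=1$ otherwise (it encodes the south-east boundary of the Young diagram, 0 = up step, 1 = right step). Any 0/1 sequence indexed by $\mathbb Z$ which is $0$ for all sufficiently small indices and $1$ for all sufficiently large indices determines a unique partition (independently of shifts of the index): its parts are the numbers of 1's preceding each 0. For $1\le i\le k$, the $i$-th component $\lambda^{(i)}$ of the $k$-quotient of $\lambda$ is the partition determined by the subsequence $(s_{i+kj})_{j\in\mathbb Z}$; $\mathrm{quot}_k(\lambda)=(\lambda^{(1)},\ldots,\lambda^{(k)})$. Removing from $\lambda$ a rim hook (connected skew shape with no $2\times2$ square) of length $L\ge1$, obtaining $\nu\subseteq\lambda$, is the same as interchanging in $s(\lambda)$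 a $1$ at some position $a$ and a $0$ at position $a+L$, which yields $s(\nu)$; the height of the rim hook (number of rows minus one) is the number of 0's strictly between these positions. The $k$-core of $\lambda$ is the partition obtained by repeatedly removing rim hooks of length $k$ until none can be removed (the result is independent of choices). A weak composition is a sequence $(\mu_1,\mu_2,\ldots)$ of nonnegative integers with finite sum $|\mu|$; $k\mu:=(k\mu_1,k\mu_2,\ldots)$. A rim hook tableau $T$ of shape $\lambda$ and type $\mu$ (with $|\mu|=|\lambda|$, $\mu_j=0$ for $j>r$) is a chain $\emptyset=\nu^0\subseteq\nu^1\subseteq\cdots\subseteq\nu^r=\lambda$ of partitions with each $\nu^j/\nu^{j-1}$ a rim hook of $\mu_j$ boxes (empty if $\mu_j=0$); $\mathrm{RHT}^\lambda_\mu$ is the set of these. Zero permutation: with $\ell=\ell(\lambda)$, label the zeros of $s(\lambda)$ at positions $\lambda_i-i+1$ ($1\le i\le\ell$) by $1,\ldots,\ell$ from left to right. Pass from $s(\nu^r)=s(\lambda)$ to $s(\nu^0)=s(\emptyset)$ by performing, for $j=r,r-1,\ldots,1$ with $\mu_j>0$, the interchange corresponding to removing $\nu^j/\nu^{j-1}$, each moved zero carrying its label. In $s(\emptyset)$ the labelled zeros occupy positions $-\ell+1,\ldots,0$; $\pi_T\in S_\ell$ is the permutation whose one-line notation is the sequence of labels at these positions, read left to right. The map $\omega^\lambda_{k\mu}$: for $\mu$ a partition with nonzero parts $\mu_1\ge\cdots\ge\mu_r$ and $T\in\mathrm{RHT}^\lambda_{k\mu}$ given by $\emptyset=\nu^0\subseteq\cdots\subseteq\nu^r=\lambda$,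 each step $\nu^j\to\nu^{j-1}$ interchanges a 1 and a 0 at positions $a$ and $a+k\mu_j$, both in the residue class $i_j\in\{1,\ldots,k\}$ of $a$ modulo $k$; this removes a rim hook of length $\mu_j$ from the $i_j$-th quotient component of $\nu^j$ and leaves the other quotient components unchanged. For each $i$, the chain of $i$-th quotient components of $\nu^0,\ldots,\nu^r$, with repetitions deleted, is a rim hook tableau $T_i$ of shape $\lambda^{(i)}$ whose type is the partition $\mu_i:=(\mu_j: i_j=i)$ (in increasing order of $j$). Set $\omega^\lambda_{k\mu}(T):=(T_1,\ldots,T_k)$. *)

theory Defs
  imports "HOL-Combinatorics.Permutations"
begin

section \<open>Partitions and their 0/1 sequences\<close>

text \<open>A partition is the list of its nonzero parts, so \<open>\<ell>(\<nu>)\<close> is \<open>length \<nu>\<close>, \<open>|\<nu>|\<close> is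
  \<open>sum_list \<nu>\<close>, and the empty partition is \<open>[]\<close>.\<close>

definition is_partition :: "nat list \<Rightarrow> bool" where
  "is_partition \<nu> \<longleftrightarrow> sorted_wrt (\<ge>) \<nu> \<and> 0 \<notin> set \<nu>"

text \<open>The part \<open>\<nu>\<^sub>i\<close>, for \<open>i \<ge> 1\<close>, padded with zeros.\<close>

definition part :: "nat list \<Rightarrow> nat \<Rightarrow> nat" where
  "part \<nu> i = (if 1 \<le> i \<and> i \<le> length \<nu> then \<nu> ! (i - 1) else 0)"

definition zero_pos :: "nat list \<Rightarrow> nat \<Rightarrow> int" where
  "zero_pos \<nu> i = int (part \<nu> i) - int i + 1"

definition zo_seq :: "nat list \<Rightarrow> int \<Rightarrow> nat" where
  "zo_seq \<nu> j = (if j \<in> zero_pos \<nu> ` {1..} then 0 else 1)"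

text \<open>The partition determined by a 0/1 sequence that is \<open>0\<close> far to the left and \<open>1\<close> far to the
  right: its parts are the numbers of ones preceding each zero. The zeros with no one to
  their left are dropped, as they give the parts \<open>0\<close>.\<close>

definition partition_of_seq :: "(int \<Rightarrow> nat) \<Rightarrow> nat list" where
  "partition_of_seq s =
     rev (map (\<lambda>j. card {i. i < j \<and> s i = 1})
              (sorted_list_of_set {j. s j = 0 \<and> (\<exists>i<j. s i = 1)}))"

text \<open>The \<open>i\<close>-th component, \<open>1 \<le> i \<le> k\<close>, of the \<open>k\<close>-quotient.\<close>

definition quot :: "nat \<Rightarrow> nat list \<Rightarrow> nat \<Rightarrow> nat list" where
  "quot k \<nu> i = partition_of_seq (\<lambda>j. zo_seq \<nu> (int i + int k * j))"


section \<open>Rim hooks, cores and rim hook tableaux\<close>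

definition diagram :: "nat list \<Rightarrow> (nat \<times> nat) set" where
  "diagram \<nu> = {(i, j). 1 \<le> i \<and> 1 \<le> j \<and> j \<le> part \<nu> i}"

definition adjacent :: "nat \<times> nat \<Rightarrow> nat \<times> nat \<Rightarrow> bool" where
  "adjacent x y \<longleftrightarrow>
     \<bar>int (fst x) - int (fst y)\<bar> + \<bar>int (snd x) - int (snd y)\<bar> = 1"

definition connected_boxes :: "(nat \<times> nat) set \<Rightarrow> bool" where
  "connected_boxes D \<longleftrightarrow>
     (\<forall>x\<in>D. \<forall>y\<in>D. (x, y) \<in> {(u, v). u \<in> D \<and> v \<in> D \<and> adjacent u v}\<^sup>*)"

definition has_square :: "(nat \<times> nat) set \<Rightarrow> bool" where
  "has_square D \<longleftrightarrow>
     (\<exists>i j. {(i, j), (i, Suc j), (Suc i, j), (Suc i, Suc j)} \<subseteq> D)"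

text \<open>\<open>\<nu>/\<rho>\<close> is a rim hook of \<open>L \<ge> 1\<close> boxes.\<close>

definition is_rim_hook :: "nat \<Rightarrow> nat list \<Rightarrow> nat list \<Rightarrow> bool" where
  "is_rim_hook L \<nu> \<rho> \<longleftrightarrow>
     is_partition \<nu> \<and> is_partition \<rho> \<and> diagram \<rho> \<subseteq> diagram \<nu> \<and>
     L \<ge> 1 \<and> card (diagram \<nu> - diagram \<rho>) = L \<and>
     connected_boxes (diagram \<nu> - diagram \<rho>) \<and> \<not> has_square (diagram \<nu> - diagram \<rho>)"

definition k_core :: "nat \<Rightarrow> nat list \<Rightarrow> nat list" where
  "k_core k \<nu> = (THE \<kappa>. (is_rim_hook k)\<^sup>*\<^sup>* \<nu> \<kappa> \<and> \<not> (\<exists>\<rho>. is_rim_hook k \<kappa> \<rho>))"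

text \<open>A weak composition is a list \<open>\<mu> = [\<mu>\<^sub>1, \<dots>, \<mu>\<^sub>r]\<close>, its further entries being \<open>0\<close>; a
  tableau of type \<open>\<mu>\<close> is the list \<open>[\<nu>\<^sup>0, \<dots>, \<nu>\<^sup>r]\<close>.\<close>

definition RHT :: "nat list \<Rightarrow> nat list \<Rightarrow> nat list list set" where
  "RHT \<nu> \<mu> = {T. sum_list \<mu> = sum_list \<nu> \<and> length T = Suc (length \<mu>) \<and>
     (\<forall>\<rho>\<in>set T. is_partition \<rho>) \<and> hd T = [] \<and> last T = \<nu> \<and>
     (\<forall>j<length \<mu>. if \<mu> ! j = 0 then T ! Suc j = T ! j
                   else is_rim_hook (\<mu> ! j) (T ! Suc j) (T ! j))}"


section \<open>The zero permutation of a tableau\<close>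

text \<open>The interchange corresponding to the removal of the rim hook \<open>\<nu>/\<rho>\<close> of length \<open>L\<close> is that of
  a \<open>1\<close> at position \<open>a\<close> and a \<open>0\<close> at position \<open>a + L\<close>; \<open>hook_pos \<nu> \<rho>\<close> is this \<open>a\<close>.\<close>

definition hook_length :: "nat list \<Rightarrow> nat list \<Rightarrow> nat" where
  "hook_length \<nu> \<rho> = card (diagram \<nu> - diagram \<rho>)"

definition hook_pos :: "nat list \<Rightarrow> nat list \<Rightarrow> int" where
  "hook_pos \<nu> \<rho> = (THE a. let b = a + int (hook_length \<nu> \<rho>) in
     zo_seq \<nu> a = 1 \<and> zo_seq \<nu> b = 0 \<and> zo_seq \<rho> = zo_seq \<nu> \<circ> transpose a b)"

text \<open>Labels are recorded as functions from positions to naturals, with value \<open>0\<close> at the positions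
  carrying no labelled zero (the ones, and the zeros beyond the first \<open>\<ell>\<close> parts).\<close>

definition initial_labels :: "nat list \<Rightarrow> int \<Rightarrow> nat" where
  "initial_labels \<nu> j = (let Z = zero_pos \<nu> ` {1..length \<nu>} in
     if j \<in> Z then card {z \<in> Z. z \<le> j} else 0)"

definition move_labels :: "nat list \<Rightarrow> nat list \<Rightarrow> (int \<Rightarrow> nat) \<Rightarrow> int \<Rightarrow> nat" where
  "move_labels \<nu> \<rho> f = (if \<nu> = \<rho> then f
     else f \<circ> transpose (hook_pos \<nu> \<rho>) (hook_pos \<nu> \<rho> + int (hook_length \<nu> \<rho>)))"

text \<open>The pairs of consecutive shapes \<open>(\<nu>\<^sup>j\<^sup>-\<^sup>1, \<nu>\<^sup>j)\<close> are processed in the order \<open>j = r, \<dots>, 1\<close>.\<close>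

definition final_labels :: "nat list list \<Rightarrow> int \<Rightarrow> nat" where
  "final_labels T =
     fold (\<lambda>(\<rho>, \<nu>). move_labels \<nu> \<rho>) (rev (zip T (tl T))) (initial_labels (last T))"

text \<open>The one-line notation of \<open>\<pi>\<^sub>T\<close> is read off at the positions \<open>-\<ell> + 1, \<dots>, 0\<close>; \<open>\<pi>\<^sub>T\<close> is extended by the
  identity outside \<open>{1..\<ell>}\<close>.\<close>

definition zero_perm :: "nat list list \<Rightarrow> nat \<Rightarrow> nat" where
  "zero_perm T q = (let l = length (last T) in
     if q \<in> {1..l} then final_labels T (int q - int l) else q)"


section \<open>The map to tuples of tableaux\<close>

text \<open>\<open>\<omega> k T i\<close> is the component \<open>T\<^sub>i\<close>, \<open>1 \<le> i \<le> k\<close>. As the quotient components increase along the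
  chain, equal members are consecutive.\<close>

definition \<omega> :: "nat \<Rightarrow> nat list list \<Rightarrow> nat \<Rightarrow> nat list list" where
  "\<omega> k T i = remdups_adj (map (\<lambda>\<nu>. quot k \<nu> i) T)"

end

theory Submission
  imports Defs
begin

text \<open>The interchanges along a tableau \<open>T\<close> compose to a bijection \<open>\<sigma>\<^sub>T\<close> from the zeros of the empty
  partition to the zeros of \<open>\<lambda>\<close>, and \<open>\<pi>\<^sub>T\<close> is \<open>\<sigma>\<^sub>T\<close> followed by ranking the zeros of \<open>\<lambda>\<close>. If all hook lengths
  are divisible by \<open>k\<close>, then \<open>\<sigma>\<^sub>T\<close> preserves residue classes modulo \<open>k\<close>, and on the class of \<open>i\<close> it is the
  bijection belonging to \<open>T\<^sub>i\<close>. A hook of length \<open>k\<close> moves a zero past no other zero of its class, so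
  \<open>\<sigma>\<^bsub>T'\<^esub>\<close> is the bijection that is increasing on every class. Hence \<open>\<pi>\<^sub>T\<close> is \<open>\<pi>\<^bsub>T'\<^esub>\<close> composed with disjoint
  copies of the permutations of the \<open>T\<^sub>i\<close>, one on each class.\<close>

section \<open>Zeros of a partition\<close>

text \<open>All interchanges act on the whole of the integers, and labels matter only when
  \<open>zero_perm\<close> is evaluated. Two obstacles shape the rest. A quotient component is read
  off its runner only up to a shift of the index, and that shift is the charge of the runner. Chains
  that start at \<open>[]\<close> with hook lengths divisible by \<open>k\<close> keep every charge
  at the common value -1, so position \<open>j\<close> of component \<open>i\<close> is position
  \<open>i + k * (j - 1)\<close> of the shape, uniformly in \<open>i\<close>. Moreover a runner may
  carry more labelled zeros of the shape than its component has parts: zeros before the first one of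
  the runner are parts 0 of the component. On these surplus places both tableaux act as the
  identity, so they contribute no factor.\<close>

definition zeros :: "nat list \<Rightarrow> int set" where
  "zeros \<nu> = zero_pos \<nu> ` {1..}"

lemma zo_seq_eq_0_iff: "zo_seq \<nu> j = 0 \<longleftrightarrow> j \<in> zeros \<nu>"
  by (simp add: zo_seq_def zeros_def)

lemma zo_seq_eq_1_iff: "zo_seq \<nu> j = 1 \<longleftrightarrow> j \<notin> zeros \<nu>"
  by (simp add: zo_seq_def zeros_def)

lemma part_antimono:
  assumes "is_partition \<nu>" "1 \<le> i" "i \<le> j"
  shows "part \<nu> j \<le> part \<nu> i"
proof (cases "i = j")
  case False
  then show ?thesis
    using assms by (auto simp: part_def is_partition_def sorted_wrt_iff_nth_less)
qed simp

lemma zero_pos_less: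
  assumes "is_partition \<nu>" "1 \<le> i" "i < j"
  shows "zero_pos \<nu> j < zero_pos \<nu> i"
  using part_antimono[OF assms(1,2), of j] assms by (simp add: zero_pos_def)

lemma zero_pos_le:
  assumes "is_partition \<nu>" "1 \<le> i" "i \<le> j"
  shows "zero_pos \<nu> j \<le> zero_pos \<nu> i"
  using part_antimono[OF assms] assms by (simp add: zero_pos_def)

lemma zero_pos_eq_iff:
  assumes "is_partition \<nu>" "1 \<le> i" "1 \<le> j"
  shows "zero_pos \<nu> i = zero_pos \<nu> j \<longleftrightarrow> i = j"
  using zero_pos_less[OF assms(1), of i j] zero_pos_less[OF assms(1), of j i] assms
  by (metis less_irrefl linorder_neqE_nat)

text \<open>If the \<open>n\<close>-th value of one enumeration is the \<open>m\<close>-th value of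
  the other, then \<open>m < n\<close> would make the first take this value twice, by the induction
  hypothesis. So \<open>m\<close> is at least \<open>n\<close>, which gives one inequality; the
  roles are then exchanged.\<close>

lemma decreasing_enumeration_unique:
  fixes f g :: "nat \<Rightarrow> int"
  assumes f: "\<And>i j. 1 \<le> i \<Longrightarrow> i < j \<Longrightarrow> f j < f i"
    and g: "\<And>i j. 1 \<le> i \<Longrightarrow> i < j \<Longrightarrow> g j < g i"
    and eq: "f ` {1..} = g ` {1..}" and "1 \<le> n"
  shows "f n = g n"
  using \<open>1 \<le> n\<close>
proof (induction n rule: less_induct)
  case (less n)
  have le: "h n \<le> h' n"
    if h: "\<And>i j. 1 \<le> i \<Longrightarrow> i < j \<Longrightarrow> h j < h i"
      and h': "\<And>i j. 1 \<le> i \<Longrightarrow> i < j \<Longrightarrow> h' j < h' i"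
      and eq: "h ` {1..} = h' ` {1..}"
      and IH: "\<And>m. 1 \<le> m \<Longrightarrow> m < n \<Longrightarrow> h m = h' m" for h h' :: "nat \<Rightarrow> int"
  proof -
    have "h n \<in> h' ` {1..}" using eq less.prems by blast
    then obtain m where m: "1 \<le> m" "h n = h' m" by auto
    have "\<not> m < n"
    proof
      assume "m < n"
      then show False using h[OF m(1)] IH[OF m(1)] m by force
    qed
    then show ?thesis
      using h'[OF less.prems, of m] m by (cases "m = n") auto
  qed
  show ?case
  proof (rule antisym)
    show "f n \<le> g n" by (rule le[OF f g eq]) (simp_all add: less.IH)
    show "g n \<le> f n" by (rule le[OF g f eq[symmetric]]) (simp_all add: less.IH)
  qed
qed

lemma part_nonzero_iff:
  assumes "is_partition \<nu>"
  shows "part \<nu> i \<noteq> 0 \<longleftrightarrow> 1 \<le> i \<and> i \<le> length \<nu>"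
proof -
  have "\<nu> ! (i - 1) \<noteq> 0" if "1 \<le> i" "i \<le> length \<nu>"
  proof -
    have "\<nu> ! (i - 1) \<in> set \<nu>" using that by (intro nth_mem) auto
    then show ?thesis using assms unfolding is_partition_def by metis
  qed
  then show ?thesis by (auto simp: part_def)
qed

lemma part_inject:
  assumes "is_partition \<nu>" "is_partition \<rho>" "\<And>i. 1 \<le> i \<Longrightarrow> part \<nu> i = part \<rho> i"
  shows "\<nu> = \<rho>"
proof (rule nth_equalityI)
  note pos = part_nonzero_iff
  have le: "length \<kappa> \<le> length \<kappa>'"
    if "is_partition \<kappa>" "is_partition \<kappa>'" "\<And>i. 1 \<le> i \<Longrightarrow> part \<kappa> i = part \<kappa>' i" for \<kappa> \<kappa>'
    using pos[OF that(1), of "length \<kappa>"] pos[OF that(2), of "length \<kappa>"] that(3)[of "length \<kappa>"]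
    by (cases "length \<kappa>") auto
  show "length \<nu> = length \<rho>"
    using le[of \<nu> \<rho>] le[of \<rho> \<nu>] assms by force
  then show "\<nu> ! i = \<rho> ! i" if "i < length \<nu>" for i
    using assms(3)[of "Suc i"] that by (simp add: part_def)
qed

lemma zeros_inject:
  assumes "is_partition \<nu>" "is_partition \<rho>" "zeros \<nu> = zeros \<rho>"
  shows "\<nu> = \<rho>"
proof (rule part_inject[OF assms(1,2)])
  fix i :: nat assume "1 \<le> i"
  then have "zero_pos \<nu> i = zero_pos \<rho> i"
    using decreasing_enumeration_unique[of "zero_pos \<nu>" "zero_pos \<rho>"] zero_pos_less assms
    by (simp add: zeros_def)
  then show "part \<nu> i = part \<rho> i" by (simp add: zero_pos_def)
qed

lemma zeros_Nil: "zeros [] = {..0}"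
proof -
  have "x \<in> zeros []" if "x \<le> 0" for x
    unfolding zeros_def using that
    by (intro image_eqI[of _ _ "nat (1 - x)"]) (auto simp: zero_pos_def part_def)
  then show ?thesis by (auto simp: zeros_def zero_pos_def part_def)
qed

lemma zero_pos_labelled:
  assumes "i \<in> {1..length \<nu>}"
  shows "zero_pos \<nu> i > - int (length \<nu>)"
  using assms by (auto simp: zero_pos_def)

lemma zeros_split: "zeros \<nu> = {..- int (length \<nu>)} \<union> zero_pos \<nu> ` {1..length \<nu>}"
proof (intro equalityI subsetI)
  fix x assume "x \<in> zeros \<nu>"
  then obtain i where "1 \<le> i" "x = zero_pos \<nu> i" by (auto simp: zeros_def)
  then show "x \<in> {..- int (length \<nu>)} \<union> zero_pos \<nu> ` {1..length \<nu>}"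
    by (cases "i \<le> length \<nu>") (auto simp: zero_pos_def part_def)
next
  fix x assume x: "x \<in> {..- int (length \<nu>)} \<union> zero_pos \<nu> ` {1..length \<nu>}"
  show "x \<in> zeros \<nu>"
  proof (cases "x \<le> - int (length \<nu>)")
    case True
    then have "x = zero_pos \<nu> (nat (1 - x))" "nat (1 - x) \<in> {1..}"
      by (auto simp: zero_pos_def part_def)
    then show ?thesis unfolding zeros_def by blast
  next
    case False
    then show ?thesis using x by (auto simp: zeros_def)
  qed
qed

lemma labelled_zeros:
  assumes "is_partition \<nu>"
  shows "zero_pos \<nu> ` {1..length \<nu>} = zeros \<nu> - {..- int (length \<nu>)}"
    and "card (zero_pos \<nu> ` {1..length \<nu>}) = length \<nu>"
proof -
  show "zero_pos \<nu> ` {1..length \<nu>} = zeros \<nu> - {..- int (length \<nu>)}"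
    using zeros_split[of \<nu>] zero_pos_labelled by fastforce
  have "inj_on (zero_pos \<nu>) {1..length \<nu>}"
    using zero_pos_eq_iff[OF assms] by (auto simp: inj_on_def)
  then show "card (zero_pos \<nu> ` {1..length \<nu>}) = length \<nu>"
    by (simp add: card_image)
qed

text \<open>The last part is positive, so the lowest labelled zero lies no lower than 2 minus the
  number of parts. This gap later keeps the copies of the components inside the labelled range of
  the whole shape.\<close>

lemma length_not_in_zeros:
  assumes "is_partition \<nu>" "\<nu> \<noteq> []"
  shows "1 - int (length \<nu>) \<notin> zeros \<nu>"
proof
  assume "1 - int (length \<nu>) \<in> zeros \<nu>"
  then have "1 - int (length \<nu>) \<in> zero_pos \<nu> ` {1..length \<nu>}"
    using labelled_zeros(1)[OF assms(1)] by simp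
  then obtain i where i: "i \<in> {1..length \<nu>}" "zero_pos \<nu> i = 1 - int (length \<nu>)" by auto
  then have "part \<nu> i = 0" by (auto simp: zero_pos_def)
  then show False
    using i part_nonzero_iff[OF assms(1), of i] by auto
qed

section \<open>Charges\<close>

text \<open>The charge of a Maya diagram, normalised so that \<open>{..c}\<close> has charge
  \<open>c\<close>. The cut \<open>N\<close> may be any place up to which the set is full; the value
  does not depend on it.\<close>

definition has_charge :: "int set \<Rightarrow> int \<Rightarrow> bool" where
  "has_charge S c \<longleftrightarrow> (\<exists>N. {..N} \<subseteq> S \<and> finite (S \<inter> {N<..}) \<and> N + int (card (S \<inter> {N<..})) = c)"

lemma has_charge_lower:
  assumes "{..N} \<subseteq> S" "finite (S \<inter> {N<..})" "M \<le> N"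
  shows "{..M} \<subseteq> S" "finite (S \<inter> {M<..})"
    "M + int (card (S \<inter> {M<..})) = N + int (card (S \<inter> {N<..}))"
proof -
  have eq: "S \<inter> {M<..} = {M<..N} \<union> (S \<inter> {N<..})"
    using assms by force
  show "{..M} \<subseteq> S" using assms by force
  show "finite (S \<inter> {M<..})" using eq assms by simp
  have "card (S \<inter> {M<..}) = card {M<..N} + card (S \<inter> {N<..})"
    unfolding eq by (rule card_Un_disjoint) (use assms in auto)
  then show "M + int (card (S \<inter> {M<..})) = N + int (card (S \<inter> {N<..}))"
    using assms by simp
qed

lemma has_charge_at:
  assumes "has_charge S c"
  obtains N where "N \<le> M" "{..N} \<subseteq> S" "finite (S \<inter> {N<..})" "N + int (card (S \<inter> {N<..})) = c"
proof -
  obtain N where N: "{..N} \<subseteq> S" "finite (S \<inter> {N<..})" "N + int (card (S \<inter> {N<..})) = c"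
    using assms unfolding has_charge_def by blast
  show thesis
    using has_charge_lower[OF N(1,2), of "min M N"] N that[of "min M N"] by auto
qed

lemma has_charge_unique:
  assumes "has_charge S c" "has_charge S d"
  shows "c = d"
proof -
  obtain N where N: "{..N} \<subseteq> S" "finite (S \<inter> {N<..})" "N + int (card (S \<inter> {N<..})) = c"
    using assms unfolding has_charge_def by blast
  obtain M where M: "M \<le> N" "M + int (card (S \<inter> {M<..})) = d"
    using has_charge_at[OF assms(2)] by metis
  show ?thesis using has_charge_lower(3)[OF N(1,2) M(1)] N(3) M(2) by simp
qed

text \<open>Nothing changes up to a cut left of both places. The order of \<open>a\<close> and
  \<open>b\<close> is left open, so that this serves removal and addition of hooks alike.\<close>

lemma has_charge_exchange:
  assumes "has_charge S c" "a \<notin> S" "b \<in> S" "S' = insert a (S - {b})"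
  shows "has_charge S' c"
proof -
  obtain N where N: "N \<le> min a b - 1" "{..N} \<subseteq> S" "finite (S \<inter> {N<..})"
      "N + int (card (S \<inter> {N<..})) = c"
    using has_charge_at[OF assms(1)] by metis
  have eq: "S' \<inter> {N<..} = insert a ((S \<inter> {N<..}) - {b})" using N(1) assms by auto
  have "card (S' \<inter> {N<..}) = card (S \<inter> {N<..})"
  proof -
    have "b \<in> S \<inter> {N<..}" using N(1) assms by auto
    then have "Suc (card ((S \<inter> {N<..}) - {b})) = card (S \<inter> {N<..})"
      using N(3) by (intro card_Suc_Diff1)
    then show ?thesis unfolding eq using N(3) assms(2) by simp
  qed
  moreover have "{..N} \<subseteq> S'" using N assms by auto
  moreover have "finite (S' \<inter> {N<..})" unfolding eq using N by simp
  ultimately show ?thesis using N unfolding has_charge_def by metis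
qed

lemma has_charge_zeros:
  assumes "is_partition \<nu>"
  shows "has_charge (zeros \<nu>) 0"
  unfolding has_charge_def
proof (intro exI conjI)
  let ?N = "- int (length \<nu>)"
  have eq: "zeros \<nu> \<inter> {?N<..} = zero_pos \<nu> ` {1..length \<nu>}"
    using labelled_zeros(1)[OF assms] by auto
  show "{..?N} \<subseteq> zeros \<nu>" using zeros_split by blast
  show "finite (zeros \<nu> \<inter> {?N<..})" unfolding eq by simp
  show "?N + int (card (zeros \<nu> \<inter> {?N<..})) = 0"
    unfolding eq labelled_zeros(2)[OF assms] by simp
qed

text \<open>Down-closed sets are comparable by inclusion, and comparable sets with equally many
  elements above a common cut coincide. For cores this gives uniqueness runner by runner.\<close>

lemma down_closed_charge_unique:
  assumes "has_charge S c" "has_charge S' c"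
    and S: "\<And>j. j \<in> S \<Longrightarrow> j - 1 \<in> S" and S': "\<And>j. j \<in> S' \<Longrightarrow> j - 1 \<in> S'"
  shows "S = S'"
proof -
  have down: "i \<in> R" if "\<And>j. j \<in> R \<Longrightarrow> j - 1 \<in> R" "j \<in> R" "i \<le> j" for R :: "int set" and i j
    using that(3,2) by (induction i rule: int_le_induct) (use that(1) in auto)
  have comparable: "S \<subseteq> S' \<or> S' \<subseteq> S"
    using down[of S] down[of S'] S S' by (metis linorder_linear subsetI)
  obtain M where M: "{..M} \<subseteq> S" "finite (S \<inter> {M<..})" "M + int (card (S \<inter> {M<..})) = c"
    using assms unfolding has_charge_def by blast
  obtain N where N: "N \<le> M" "{..N} \<subseteq> S'" "finite (S' \<inter> {N<..})"
      "N + int (card (S' \<inter> {N<..})) = c"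
    using has_charge_at[OF assms(2)] by metis
  note L = has_charge_lower[OF M(1,2) N(1)]
  have "card (S \<inter> {N<..}) = card (S' \<inter> {N<..})" using L N M by linarith
  then have "S \<inter> {N<..} = S' \<inter> {N<..}"
    using comparable card_subset_eq[of "S' \<inter> {N<..}" "S \<inter> {N<..}"]
      card_subset_eq[of "S \<inter> {N<..}" "S' \<inter> {N<..}"] L N by (metis Int_mono order_refl)
  moreover have "S \<inter> {..N} = S' \<inter> {..N}" using L N by auto
  moreover have "R = (R \<inter> {N<..}) \<union> (R \<inter> {..N})" for R :: "int set" by auto
  ultimately show ?thesis by metis
qed

section \<open>Reading a partition off a sequence of known charge\<close>

lemma card_below_nth_sorted_list_of_set:
  assumes "finite (W :: int set)" "q < card W"
  shows "card {i \<in> W. i < sorted_list_of_set W ! q} = q"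
proof -
  let ?xs = "sorted_list_of_set W"
  have len: "length ?xs = card W" by simp
  have set: "set ?xs = W" using assms by simp
  have lt: "?xs ! i < ?xs ! j \<longleftrightarrow> i < j" if "i < card W" "j < card W" for i j
    using strict_sorted_list_of_set[of W] that len
    by (metis linorder_neqE_nat order_less_asym sorted_wrt_nth_less less_irrefl)
  have "{i \<in> W. i < ?xs ! q} = (\<lambda>i. ?xs ! i) ` {..<q}"
  proof (intro equalityI subsetI)
    fix x assume "x \<in> {i \<in> W. i < ?xs ! q}"
    then obtain i where "i < card W" "x = ?xs ! i" "x < ?xs ! q"
      using set len by (metis (mono_tags, lifting) in_set_conv_nth mem_Collect_eq)
    then show "x \<in> (\<lambda>i. ?xs ! i) ` {..<q}" using lt assms by auto
  next
    fix x assume "x \<in> (\<lambda>i. ?xs ! i) ` {..<q}"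
    then obtain i where "i < q" "x = ?xs ! i" by auto
    then show "x \<in> {i \<in> W. i < ?xs ! q}" using lt[of i q] assms set len nth_mem[of i ?xs] by auto
  qed
  moreover have "inj_on (\<lambda>i. ?xs ! i) {..<q}"
    using assms by (intro inj_onI) (metis lt lessThan_iff less_trans less_irrefl linorder_neqE_nat)
  ultimately show ?thesis by (simp add: card_image)
qed

text \<open>Passing to the partition forgets the index shift, and the charge restores it. If
  \<open>m\<close> is the place before the first one, then \<open>xs ! q\<close> has
  \<open>xs ! q - m - 1 - q\<close> ones before it. As it becomes the part of index
  \<open>l - q\<close>, its position is lowered by exactly \<open>m + l\<close>, which is the
  charge.\<close>

lemma partition_of_seq_zeros:
  assumes s: "\<And>j. s j = 0 \<or> s j = (1::nat)" and S: "S = {j. s j = 0}" and ch: "has_charge S c"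
  shows "is_partition (partition_of_seq s)" "zeros (partition_of_seq s) = {j. j + c \<in> S}"
proof -
  have s1: "s j = 1 \<longleftrightarrow> j \<notin> S" for j using s[of j] S by auto
  have s0: "s j = 0 \<longleftrightarrow> j \<in> S" for j using S by auto
  obtain N where N: "{..N} \<subseteq> S" "finite (S \<inter> {N<..})"
    using ch unfolding has_charge_def by blast
  obtain m where m: "{..m} \<subseteq> S" "m + 1 \<notin> S"
  proof -
    have "\<not> {N<..} \<subseteq> S" using N(2) infinite_Ioi[of N] by (metis Int_absorb1)
    then obtain x where x: "x > N" "x \<notin> S" by auto
    \<comment> \<open>The first one is found by searching upwards from a cut \<open>N\<close> up to
      which only zeros occur.\<close>
    define n where "n = (LEAST n::nat. N + 1 + int n \<notin> S)"
    have "N + 1 + int (nat (x - N - 1)) \<notin> S" using x by auto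
    then have n: "N + 1 + int n \<notin> S" unfolding n_def by (rule LeastI)
    have "y \<in> S" if "y \<le> N + int n" for y
    proof (cases "y \<le> N")
      case False
      then have "nat (y - N - 1) < n" using that by auto
      then have "\<not> N + 1 + int (nat (y - N - 1)) \<notin> S" unfolding n_def by (rule not_less_Least)
      then show ?thesis using False by auto
    qed (use N in auto)
    then show thesis using that[of "N + int n"] n by (auto simp: algebra_simps)
  qed
  define W where "W = S \<inter> {m<..}"
  have Weq: "{j. s j = 0 \<and> (\<exists>i<j. s i = 1)} = W"
    unfolding W_def s0 s1
  proof safe
    fix x i assume "x \<in> S" "i < x" "i \<notin> S"
    then show "m < x" using m(1) by (metis atMost_iff leI order_less_trans subsetD)
  next
    fix x assume "x \<in> S" "m < x"
    then show "\<exists>i<x. i \<notin> S" using m(2) by (intro exI[of _ "m+1"]) (metis zless_imp_add1_zle order_le_less)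
  qed
  have "N \<le> m"
    using m(2) N(1) by (metis atMost_iff linorder_not_less subsetD zless_imp_add1_zle)
  then have finW: "finite W" unfolding W_def using N(2) by (elim rev_finite_subset) auto
  define l where "l = card W"
  have c: "c = m + int l"
    using has_charge_unique[OF ch, of "m + int l"] m finW
    unfolding has_charge_def W_def l_def by blast
  define xs where "xs = sorted_list_of_set W"
  define h where "h = (\<lambda>j. card {i. i < j \<and> s i = 1})"
  define \<nu> where "\<nu> = partition_of_seq s"
  have nu: "\<nu> = rev (map h xs)"
    unfolding \<nu>_def partition_of_seq_def Weq h_def xs_def by simp
  have len: "length xs = l" "length \<nu> = l" unfolding nu xs_def l_def by simp_all
  have setxs: "set xs = W" unfolding xs_def using finW by simp
  have holes: "{i. i < j \<and> s i = 1} = {m<..<j} - {i\<in>W. i < j}" for j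
    unfolding s1 W_def using m(1) by (auto simp: not_le[symmetric])
  have h: "int (h (xs ! q)) = xs ! q - m - 1 - int q" if "q < l" for q
  proof -
    have "xs ! q \<in> W" using that len setxs nth_mem by metis
    then have "m < xs ! q" by (simp add: W_def)
    have "{i\<in>W. i < xs ! q} \<subseteq> {m<..<xs ! q}" by (auto simp: W_def)
    moreover have "card {i\<in>W. i < xs ! q} = q"
      unfolding xs_def using card_below_nth_sorted_list_of_set[OF finW, of q] that l_def by simp
    moreover have "finite {i\<in>W. i < xs ! q}" using finW by simp
    ultimately have "card ({m<..<xs ! q} - {i\<in>W. i < xs ! q}) = card {m<..<xs ! q} - q"
        "q \<le> card {m<..<xs ! q}"
      using card_Diff_subset[of "{i\<in>W. i < xs ! q}" "{m<..<xs ! q}"]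
        card_mono[of "{m<..<xs ! q}" "{i\<in>W. i < xs ! q}"] by auto
    then show ?thesis unfolding h_def holes using \<open>m < xs ! q\<close> by simp
  qed
  have hpos: "h j \<noteq> 0" if "j \<in> W" for j
  proof -
    have "m + 1 \<in> {i. i < j \<and> s i = 1}"
      using that m(2) unfolding W_def s1 by (auto simp: order_less_le)
    moreover have "finite {i. i < j \<and> s i = 1}" unfolding holes by simp
    ultimately show ?thesis unfolding h_def by auto
  qed
  have hmono: "h x \<le> h y" if "x \<le> y" for x y
  proof -
    have "finite {i. i < y \<and> s i = 1}" unfolding holes by simp
    then show ?thesis unfolding h_def by (rule card_mono) (use that in auto)
  qed
  have "sorted xs" unfolding xs_def by simp
  then have "sorted (map h xs)"
    using hmono by (auto simp: sorted_iff_nth_mono)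
  then have "sorted_wrt (\<ge>) \<nu>" unfolding nu sorted_wrt_rev by simp
  moreover have "0 \<notin> set \<nu>" unfolding nu set_rev set_map using setxs hpos by (metis imageE)
  ultimately show part: "is_partition (partition_of_seq s)" unfolding is_partition_def \<nu>_def by simp
  have zp: "zero_pos \<nu> i = xs ! (l - i) - c" if "i \<in> {1..l}" for i
  proof -
    have "\<nu> ! (i - 1) = h (xs ! (l - i))"
    proof -
      have "Suc (i - 1) = i" "i - 1 < l" "l - i < l" using that by auto
      then show ?thesis unfolding nu using len by (simp add: rev_nth)
    qed
    then show ?thesis
      using h[of "l - i"] that len c by (simp add: zero_pos_def part_def of_nat_diff)
  qed
  have "zero_pos \<nu> ` {1..l} = (\<lambda>z. z - c) ` W"
  proof -
    have "W = (\<lambda>q. xs ! q) ` {..<l}" using setxs len by (metis lessThan_atLeast0 list.set_map map_nth set_upt)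
    moreover have "{..<l} = (\<lambda>i. l - i) ` {1..l}"
    proof (intro equalityI subsetI)
      fix q assume "q \<in> {..<l}"
      then show "q \<in> (\<lambda>i. l - i) ` {1..l}" by (intro image_eqI[of _ _ "l - q"]) auto
    qed auto
    ultimately have "W = (\<lambda>i. xs ! (l - i)) ` {1..l}" by (simp add: image_image)
    then show ?thesis using zp by (simp add: image_image)
  qed
  then have Z: "zeros \<nu> = {..- int l} \<union> (\<lambda>z. z - c) ` W" using zeros_split[of \<nu>] len by simp
  have SW: "S = {..m} \<union> W" using m(1) unfolding W_def by auto
  show "zeros (partition_of_seq s) = {j. j + c \<in> S}"
    unfolding \<nu>_def[symmetric] Z SW using c
    by (auto simp: algebra_simps image_iff)
qed

section \<open>Rim hooks as interchanges\<close>

text \<open>The rim hook seen on zero sets alone: the zero at \<open>b\<close> drops to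
  \<open>a\<close>, and the length is \<open>b - a\<close>. Once this is shown equivalent to
  \<open>is_rim_hook\<close>, the arguments about labels use only this form.\<close>

definition hook_at :: "int \<Rightarrow> int \<Rightarrow> nat list \<Rightarrow> nat list \<Rightarrow> bool" where
  "hook_at a b \<nu> \<rho> \<longleftrightarrow> is_partition \<nu> \<and> is_partition \<rho> \<and> a < b \<and> a \<notin> zeros \<nu> \<and> b \<in> zeros \<nu> \<and>
     zeros \<rho> = insert a (zeros \<nu> - {b})"

text \<open>The row description of a rim hook \<open>\<nu>/\<rho>\<close> occupying exactly the rows \<open>r, \<dots>, t\<close>.\<close>

definition strip :: "nat list \<Rightarrow> nat list \<Rightarrow> nat \<Rightarrow> nat \<Rightarrow> bool" where
  "strip \<nu> \<rho> r t \<longleftrightarrow> is_partition \<nu> \<and> is_partition \<rho> \<and> 1 \<le> r \<and> r \<le> t \<and>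
     (\<forall>i\<ge>1. i < r \<or> t < i \<longrightarrow> part \<rho> i = part \<nu> i) \<and>
     (\<forall>i. r \<le> i \<and> i < t \<longrightarrow> part \<nu> (Suc i) = Suc (part \<rho> i)) \<and> part \<rho> t < part \<nu> t"

text \<open>The overlap condition on rows \<open>i\<close> and \<open>Suc i\<close> says that the
  zero of index \<open>Suc i\<close> becomes the zero of index \<open>i\<close>. Removing the hook
  thus shifts indices inside its rows and creates a new position only in row
  \<open>t\<close>.\<close>

lemma strip_zero_pos:
  assumes "strip \<nu> \<rho> r t"
  shows "1 \<le> i \<Longrightarrow> i < r \<or> t < i \<Longrightarrow> zero_pos \<rho> i = zero_pos \<nu> i"
    and "r \<le> i \<Longrightarrow> i < t \<Longrightarrow> zero_pos \<rho> i = zero_pos \<nu> (Suc i)"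
    and "zero_pos \<rho> t < zero_pos \<nu> t"
  using assms by (auto simp: strip_def zero_pos_def)

lemma strip_row_nonempty:
  assumes "strip \<nu> \<rho> r t" "r \<le> i" "i \<le> t"
  shows "part \<rho> i < part \<nu> i"
proof (cases "i = t")
  case False
  then have "part \<nu> (Suc i) = Suc (part \<rho> i)" using assms by (simp add: strip_def)
  moreover have "part \<nu> (Suc i) \<le> part \<nu> i"
    using assms by (intro part_antimono) (auto simp: strip_def)
  ultimately show ?thesis by simp
qed (use assms in \<open>auto simp: strip_def\<close>)

text \<open>By the index shift the shapes share all zeros but that of row \<open>r\<close> in \<nu>
  and that of row \<open>t\<close> in \<rho>. The latter lies strictly between the zeros of \<nu> in
  rows \<open>Suc t\<close> and \<open>t\<close>, hence on a one.\<close>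

lemma strip_hook_at:
  assumes "strip \<nu> \<rho> r t"
  shows "hook_at (zero_pos \<rho> t) (zero_pos \<nu> r) \<nu> \<rho>"
proof -
  have part: "is_partition \<nu>" "is_partition \<rho>" and rt: "1 \<le> r" "r \<le> t"
    using assms by (auto simp: strip_def)
  note Z = strip_zero_pos[OF assms]
  have less: "zero_pos \<rho> t < zero_pos \<nu> r" using Z(3) zero_pos_le[OF part(1) rt] by simp
  have notin: "zero_pos \<rho> t \<notin> zeros \<nu>"
  proof
    assume "zero_pos \<rho> t \<in> zeros \<nu>"
    then obtain i where i: "1 \<le> i" "zero_pos \<rho> t = zero_pos \<nu> i" by (auto simp: zeros_def)
    show False
    proof (cases "i \<le> t")
      case True
      then show False using zero_pos_le[OF part(1) i(1)] Z(3) i by fastforce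
    next
      case False
      then have "zero_pos \<rho> i = zero_pos \<nu> i" using Z(1) i by auto
      then show False using zero_pos_less[OF part(2), of t i] False i rt by simp
    qed
  qed
  have "zeros \<rho> = insert (zero_pos \<rho> t) (zeros \<nu> - {zero_pos \<nu> r})"
  proof (intro equalityI subsetI)
    fix x assume "x \<in> zeros \<rho>"
    then obtain i where i: "1 \<le> i" "x = zero_pos \<rho> i" by (auto simp: zeros_def)
    consider "i < r \<or> t < i" | "r \<le> i" "i < t" | "i = t" by linarith
    then show "x \<in> insert (zero_pos \<rho> t) (zeros \<nu> - {zero_pos \<nu> r})"
    proof cases
      case 1
      then show ?thesis using i Z(1) zero_pos_eq_iff[OF part(1) i(1) rt(1)] rt by (auto simp: zeros_def)
    next
      case 2
      then show ?thesis using i Z(2) zero_pos_eq_iff[OF part(1) _ rt(1), of "Suc i"] by (auto simp: zeros_def)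
    qed (use i in simp)
  next
    fix x assume "x \<in> insert (zero_pos \<rho> t) (zeros \<nu> - {zero_pos \<nu> r})"
    then consider "x = zero_pos \<rho> t" | i where "1 \<le> i" "x = zero_pos \<nu> i" "i \<noteq> r"
      by (auto simp: zeros_def)
    then show "x \<in> zeros \<rho>"
    proof cases
      case 1
      then show ?thesis using rt by (auto simp: zeros_def)
    next
      case (2 i)
      show ?thesis
      proof (cases "i < r \<or> t < i")
        case True
        then have "x = zero_pos \<rho> i" using 2 Z(1) by simp
        then show ?thesis using 2 by (auto simp: zeros_def)
      next
        case False
        then have "x = zero_pos \<rho> (i - 1)" "1 \<le> i - 1" using 2 Z(2)[of "i - 1"] rt by auto
        then show ?thesis by (auto simp: zeros_def)
      qed
    qed
  qed
  then show ?thesis unfolding hook_at_def using part less notin rt by (auto simp: zeros_def)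
qed

lemma hook_at_strip:
  assumes "hook_at a b \<nu> \<rho>"
  obtains r t where "strip \<nu> \<rho> r t" "a = zero_pos \<rho> t" "b = zero_pos \<nu> r"
proof -
  have part: "is_partition \<nu>" "is_partition \<rho>" and ab: "a < b" "a \<notin> zeros \<nu>" "b \<in> zeros \<nu>"
    and eq: "zeros \<rho> = insert a (zeros \<nu> - {b})"
    using assms by (auto simp: hook_at_def)
  obtain r where r: "1 \<le> r" "zero_pos \<nu> r = b" using ab by (auto simp: zeros_def)
  \<comment> \<open>The lowest row of the hook is that of the last zero of \<nu> above
    \<open>a\<close>; the bound by the first part makes this maximum exist.\<close>
  define I where "I = {i. 1 \<le> i \<and> a < zero_pos \<nu> i}"
  have "i < nat (int (part \<nu> 1) + 1 - a)" if "i \<in> I" for i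
    using that part_antimono[OF part(1), of 1 i] by (auto simp: I_def zero_pos_def)
  then have "finite I" by (meson finite_nat_set_iff_bounded)
  define t where "t = Max I"
  have "r \<in> I" using r ab by (simp add: I_def)
  then have "t \<in> I" "r \<le> t" unfolding t_def using \<open>finite I\<close> by (auto intro: Max_in)
  then have t: "a < zero_pos \<nu> t" "r \<le> t" by (auto simp: I_def)
  have below: "zero_pos \<nu> i < a" if "t < i" for i
  proof -
    have "i \<notin> I" using that Max_ge[OF \<open>finite I\<close>, of i] unfolding t_def by (meson not_le)
    then have "zero_pos \<nu> i \<le> a" using that by (auto simp: I_def)
    moreover have "zero_pos \<nu> i \<in> zeros \<nu>" using that by (auto simp: zeros_def)
    ultimately show ?thesis using ab by (metis order_less_le)
  qed
  \<comment> \<open>The decreasing enumeration forced by deleting index \<open>r\<close> and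
    inserting \<open>a\<close> after index \<open>t\<close>; uniqueness identifies it with
    \<open>zero_pos \<rho>\<close>.\<close>
  define g where "g = (\<lambda>i. if r \<le> i \<and> i < t then zero_pos \<nu> (Suc i) else if i = t then a
    else zero_pos \<nu> i)"
  have Suc: "g (Suc i) < g i" if "1 \<le> i" for i
  proof -
    note lt = zero_pos_less[OF part(1)]
    consider "Suc i < r \<or> t < i" | "Suc i = r" "r < t" | "Suc i = r" "r = t" | "r \<le> i" "Suc i < t"
      | "r \<le> i" "Suc i = t" | "i = t" using t by linarith
    then show ?thesis
    proof cases
      case 1 then show ?thesis using lt[OF that, of "Suc i"] t by (auto simp: g_def)
    next
      case 2 then show ?thesis using lt[OF that, of "Suc (Suc i)"] by (auto simp: g_def)
    next
      case 3 then show ?thesis using lt[OF that, of "Suc i"] t by (auto simp: g_def)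
    next
      case 4 then show ?thesis using lt[of "Suc i" "Suc (Suc i)"] by (auto simp: g_def)
    next
      case 5 then show ?thesis using t by (auto simp: g_def)
    next
      case 6 then show ?thesis using below[of "Suc i"] by (auto simp: g_def)
    qed
  qed
  have g_less: "g j < g i" if "1 \<le> i" "i < j" for i j
    using that(2,1) by (induction i j rule: less_Suc_induct) (use Suc in force)+
  have "g ` {1..} = zeros \<rho>"
  proof (intro equalityI subsetI)
    fix x assume "x \<in> g ` {1..}"
    then obtain i where i: "1 \<le> i" "x = g i" by auto
    show "x \<in> zeros \<rho>" unfolding eq
      using i zero_pos_eq_iff[OF part(1) _ r(1)] r t by (auto simp: g_def zeros_def)
  next
    fix x assume "x \<in> zeros \<rho>"
    then consider "x = a" | i where "1 \<le> i" "x = zero_pos \<nu> i" "i \<noteq> r"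
      unfolding eq using r by (auto simp: zeros_def)
    then show "x \<in> g ` {1..}"
    proof cases
      case 1
      then have "x = g t" "1 \<le> t" using r t by (auto simp: g_def)
      then show ?thesis by auto
    next
      case (2 i)
      show ?thesis
      proof (cases "r < i \<and> i \<le> t")
        case True
        then have "x = g (i - 1)" "1 \<le> i - 1" using 2 r by (auto simp: g_def)
        then show ?thesis by auto
      next
        case False
        then have "x = g i" using 2 t by (auto simp: g_def)
        then show ?thesis using 2 by auto
      qed
    qed
  qed
  then have range: "zero_pos \<rho> ` {1..} = g ` {1..}" by (simp add: zeros_def)
  have zg: "zero_pos \<rho> i = g i" if "1 \<le> i" for i
    by (rule decreasing_enumeration_unique[OF zero_pos_less[OF part(2)] g_less range that])
  have "strip \<nu> \<rho> r t"
    unfolding strip_def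
  proof (intro conjI allI impI part r(1) t(2))
    fix i assume "1 \<le> i" "i < r \<or> t < i"
    then have "zero_pos \<rho> i = zero_pos \<nu> i" using zg t by (auto simp: g_def)
    then show "part \<rho> i = part \<nu> i" by (simp add: zero_pos_def)
  next
    fix i assume "r \<le> i \<and> i < t"
    then have "zero_pos \<rho> i = zero_pos \<nu> (Suc i)" using zg r t by (auto simp: g_def)
    then show "part \<nu> (Suc i) = Suc (part \<rho> i)" by (simp add: zero_pos_def)
  next
    have "zero_pos \<rho> t < zero_pos \<nu> t" using zg[of t] r t by (auto simp: g_def)
    then show "part \<rho> t < part \<nu> t" by (simp add: zero_pos_def)
  qed
  moreover have "a = zero_pos \<rho> t" using zg[of t] r t by (auto simp: g_def)
  ultimately show thesis using that r by blast
qed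

text \<open>Row lengths of the hook are differences of zero positions of equal index, and their sum
  telescopes by the index shift.\<close>

lemma strip_diagram:
  assumes "strip \<nu> \<rho> r t"
  shows "diagram \<rho> \<subseteq> diagram \<nu>"
    and "diagram \<nu> - diagram \<rho> = Sigma {r..t} (\<lambda>i. {part \<rho> i<..part \<nu> i})"
    and "int (card (diagram \<nu> - diagram \<rho>)) = zero_pos \<nu> r - zero_pos \<rho> t"
proof -
  have rt: "1 \<le> r" "r \<le> t" using assms by (auto simp: strip_def)
  have le: "part \<rho> i \<le> part \<nu> i" if "1 \<le> i" for i
    using assms strip_row_nonempty[OF assms, of i] that
    by (cases "r \<le> i \<and> i \<le> t") (auto simp: strip_def)
  then show "diagram \<rho> \<subseteq> diagram \<nu>" by (force simp: diagram_def)
  have out: "part \<rho> i = part \<nu> i" if "1 \<le> i" "\<not> (r \<le> i \<and> i \<le> t)" for i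
    using assms that by (auto simp: strip_def)
  show *: "diagram \<nu> - diagram \<rho> = Sigma {r..t} (\<lambda>i. {part \<rho> i<..part \<nu> i})"
  proof (intro set_eqI)
    fix x :: "nat \<times> nat"
    obtain i j where x: "x = (i, j)" by (cases x)
    show "x \<in> diagram \<nu> - diagram \<rho> \<longleftrightarrow> x \<in> Sigma {r..t} (\<lambda>i. {part \<rho> i<..part \<nu> i})"
      unfolding x using out[of i] rt by (cases "r \<le> i \<and> i \<le> t") (auto simp: diagram_def)
  qed
  have "int (card (diagram \<nu> - diagram \<rho>)) = (\<Sum>i\<in>{r..t}. zero_pos \<nu> i - zero_pos \<rho> i)"
    unfolding * using le rt by (simp add: card_SigmaI zero_pos_def of_nat_diff)
  also have "\<dots> = (\<Sum>i\<in>{r..t}. zero_pos \<nu> i) - (\<Sum>i\<in>{r..t}. zero_pos \<rho> i)"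
    by (simp add: sum_subtractf)
  also have "(\<Sum>i\<in>{r..t}. zero_pos \<rho> i) = (\<Sum>i\<in>{r..<t}. zero_pos \<nu> (Suc i)) + zero_pos \<rho> t"
    using rt strip_zero_pos(2)[OF assms] by (simp add: sum.last_plus)
  also have "(\<Sum>i\<in>{r..<t}. zero_pos \<nu> (Suc i)) = (\<Sum>i\<in>{Suc r..t}. zero_pos \<nu> i)"
    by (metis atLeastLessThanSuc_atLeastAtMost sum.shift_bounds_Suc_ivl)
  also have "(\<Sum>i\<in>{r..t}. zero_pos \<nu> i) = zero_pos \<nu> r + (\<Sum>i\<in>{Suc r..t}. zero_pos \<nu> i)"
    using rt by (simp add: sum.atLeast_Suc_atMost)
  finally show "int (card (diagram \<nu> - diagram \<rho>)) = zero_pos \<nu> r - zero_pos \<rho> t" by simp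
qed

text \<open>Row \<open>Suc i\<close> of the hook ends in the column in which row \<open>i\<close>
  begins. So consecutive rows share exactly one column, which rules out squares and still connects
  the rows.\<close>

lemma strip_imp_rim_hook:
  assumes "strip \<nu> \<rho> r t"
  shows "is_rim_hook (card (diagram \<nu> - diagram \<rho>)) \<nu> \<rho>"
proof -
  have part: "is_partition \<nu>" "is_partition \<rho>" and rt: "1 \<le> r" "r \<le> t"
    using assms by (auto simp: strip_def)
  note D = strip_diagram[OF assms]
  define D where "D = diagram \<nu> - diagram \<rho>"
  have D_iff: "(i, j) \<in> D \<longleftrightarrow> r \<le> i \<and> i \<le> t \<and> part \<rho> i < j \<and> j \<le> part \<nu> i" for i j
    unfolding D_def D(2) by auto
  have next_row: "part \<nu> (Suc i) = Suc (part \<rho> i)" if "r \<le> i" "i < t" for i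
    using assms that by (simp add: strip_def)
  have "zero_pos \<rho> t < zero_pos \<nu> r"
    using strip_hook_at[OF assms] by (simp add: hook_at_def)
  then have card: "card (diagram \<nu> - diagram \<rho>) \<ge> 1"
    using D(3) by linarith
  have no_sq: "\<not> has_square D"
    unfolding has_square_def
  proof clarify
    fix i j assume "{(i, j), (i, Suc j), (Suc i, j), (Suc i, Suc j)} \<subseteq> D"
    then have "part \<rho> i < j" "Suc j \<le> part \<nu> (Suc i)" "r \<le> i" "i < t" by (auto simp: D_iff)
    then show False using next_row by simp
  qed
  define R where "R = {(u, v). u \<in> D \<and> v \<in> D \<and> adjacent u v}"
  have "sym R" by (auto simp: R_def sym_def adjacent_def)
  text \<open>Every box is joined to the lower left end of the hook, by walking left and down.\<close>
  have to_end: "((i, j), (t, Suc (part \<rho> t))) \<in> R\<^sup>*" if "(i, j) \<in> D" for i j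
    using that
  proof (induction "(t - i) + j" arbitrary: i j rule: less_induct)
    case less
    have ij: "r \<le> i" "i \<le> t" "part \<rho> i < j" "j \<le> part \<nu> i" using less.prems by (auto simp: D_iff)
    consider "Suc (part \<rho> i) < j" | "j = Suc (part \<rho> i)" "i < t" | "j = Suc (part \<rho> i)" "i = t"
      using ij by linarith
    then show ?case
    proof cases
      case 1
      then have "(i, j - 1) \<in> D" using ij by (auto simp: D_iff)
      then have "((i, j), (i, j - 1)) \<in> R" "((i, j - 1), (t, Suc (part \<rho> t))) \<in> R\<^sup>*"
        using less.prems less.hyps[of i "j - 1"] 1 by (auto simp: R_def adjacent_def)
      then show ?thesis by (rule converse_rtrancl_into_rtrancl)
    next
      case 2
      then have "j = part \<nu> (Suc i)" using next_row ij by simp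
      then have "(Suc i, j) \<in> D"
        using ij 2 strip_row_nonempty[OF assms, of "Suc i"] by (auto simp: D_iff)
      then have "((i, j), (Suc i, j)) \<in> R" "((Suc i, j), (t, Suc (part \<rho> t))) \<in> R\<^sup>*"
        using less.prems less.hyps[of "Suc i" j] 2 by (auto simp: R_def adjacent_def)
      then show ?thesis by (rule converse_rtrancl_into_rtrancl)
    qed simp
  qed
  have "connected_boxes D"
    unfolding connected_boxes_def R_def[symmetric]
  proof clarify
    fix i j i' j' assume "(i, j) \<in> D" "(i', j') \<in> D"
    then show "((i, j), (i', j')) \<in> R\<^sup>*"
      using to_end sym_rtrancl[OF \<open>sym R\<close>] by (metis rtrancl_trans symD)
  qed
  then show ?thesis
    unfolding is_rim_hook_def using part D(1) card no_sq D_def by simp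
qed

text \<open>Of the equation for consecutive rows, one inequality comes from the absence of squares,
  the other from connectedness.\<close>

lemma rim_hook_imp_strip:
  assumes "is_rim_hook L \<nu> \<rho>"
  obtains r t where "strip \<nu> \<rho> r t"
proof -
  define D where "D = diagram \<nu> - diagram \<rho>"
  have part: "is_partition \<nu>" "is_partition \<rho>" and sub: "diagram \<rho> \<subseteq> diagram \<nu>"
    and card: "card D \<ge> 1" and conn: "connected_boxes D" and nsq: "\<not> has_square D"
    using assms by (auto simp: is_rim_hook_def D_def)
  have fin: "finite D" "D \<noteq> {}" using card by (auto intro: card_ge_0_finite)
  have D_iff: "(i, j) \<in> D \<longleftrightarrow> 1 \<le> i \<and> part \<rho> i < j \<and> j \<le> part \<nu> i" for i j
    by (auto simp: D_def diagram_def)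
  have le: "part \<rho> i \<le> part \<nu> i" if "1 \<le> i" for i
  proof (rule ccontr)
    assume "\<not> ?thesis"
    then have "(i, part \<rho> i) \<in> diagram \<rho>" "(i, part \<rho> i) \<notin> diagram \<nu>"
      using that by (auto simp: diagram_def)
    then show False using sub by blast
  qed
  have next_le: "part \<nu> (Suc i) \<le> Suc (part \<rho> i)" if "1 \<le> i" for i
  proof (rule ccontr)
    assume "\<not> ?thesis"
    moreover have "part \<rho> (Suc i) \<le> part \<rho> i" "part \<nu> (Suc i) \<le> part \<nu> i"
      using part_antimono[of _ i "Suc i"] part that by auto
    ultimately have "{(i, Suc (part \<rho> i)), (i, Suc (Suc (part \<rho> i))),
        (Suc i, Suc (part \<rho> i)), (Suc i, Suc (Suc (part \<rho> i)))} \<subseteq> D"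
      using that by (auto simp: D_iff)
    then show False using nsq unfolding has_square_def by blast
  qed
  define r t where "r = Min (fst ` D)" and "t = Max (fst ` D)"
  have "r \<in> fst ` D" "t \<in> fst ` D" unfolding r_def t_def using fin by (auto intro: Min_in Max_in)
  then obtain j j' where rj: "(r, j) \<in> D" and tj: "(t, j') \<in> D" by auto
  have bounds: "r \<le> i" "i \<le> t" if "(i, j) \<in> D" for i j
    using that fin unfolding r_def t_def by (auto intro!: Min_le Max_ge simp: image_iff Bex_def; blast)+
  \<comment> \<open>A path from row \<open>r\<close> to row \<open>t\<close> changes its row by at
    most one per step, so it passes from row \<open>i\<close> to row \<open>Suc i\<close> by a
    vertical step; without such a pair of boxes it could never leave the rows up to
    \<open>i\<close>.\<close>
  have cross: "\<exists>j. (i, j) \<in> D \<and> (Suc i, j) \<in> D" if "r \<le> i" "i < t" for i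
  proof (rule ccontr)
    assume no: "\<not> ?thesis"
    have "((r, j), (t, j')) \<in> {(u, v). u \<in> D \<and> v \<in> D \<and> adjacent u v}\<^sup>*"
      using conn rj tj unfolding connected_boxes_def by blast
    then have "fst (t, j') \<le> i"
    proof (induction rule: rtrancl_induct)
      case base
      then show ?case using that by simp
    next
      case (step u v)
      show ?case
      proof (rule ccontr)
        assume "\<not> fst v \<le> i"
        then have "fst u = i" "fst v = Suc i" "snd u = snd v"
          using step.hyps(2) step.IH by (auto simp: adjacent_def)
        then show False using no step.hyps(2)
          by (metis (mono_tags, lifting) case_prodD mem_Collect_eq prod.collapse)
      qed
    qed
    then show False using that by simp
  qed
  have "strip \<nu> \<rho> r t"
    unfolding strip_def
  proof (intro conjI allI impI part)
    show "1 \<le> r" "r \<le> t" "part \<rho> t < part \<nu> t" using rj tj bounds by (auto simp: D_iff)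
    fix i
    show "part \<rho> i = part \<nu> i" if "1 \<le> i" "i < r \<or> t < i"
    proof (rule ccontr)
      assume "part \<rho> i \<noteq> part \<nu> i"
      then have "(i, part \<nu> i) \<in> D" using le[OF that(1)] that by (auto simp: D_iff)
      then show False using bounds that(2) by fastforce
    qed
    show "part \<nu> (Suc i) = Suc (part \<rho> i)" if i: "r \<le> i \<and> i < t"
    proof -
      obtain j where "(i, j) \<in> D" "(Suc i, j) \<in> D" using cross i by blast
      then show ?thesis using next_le[of i] by (auto simp: D_iff)
    qed
  qed
  then show thesis by (rule that)
qed

section \<open>Equivalence of the diagram and the 0/1 descriptions of rim hooks\<close>

lemma hook_at_card:
  assumes "hook_at a b \<nu> \<rho>"
  shows "int (hook_length \<nu> \<rho>) = b - a"
  using assms unfolding hook_length_def by (metis hook_at_strip strip_diagram(3))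

lemma rim_hook_iff_hook_at:
  "is_rim_hook L \<nu> \<rho> \<longleftrightarrow> (\<exists>a. hook_at a (a + int L) \<nu> \<rho>)"
proof
  assume rh: "is_rim_hook L \<nu> \<rho>"
  then obtain r t where "strip \<nu> \<rho> r t" using rim_hook_imp_strip by blast
  then have h: "hook_at (zero_pos \<rho> t) (zero_pos \<nu> r) \<nu> \<rho>" by (rule strip_hook_at)
  have "hook_length \<nu> \<rho> = L" using rh by (simp add: hook_length_def is_rim_hook_def)
  then have "zero_pos \<nu> r = zero_pos \<rho> t + int L" using hook_at_card[OF h] by simp
  then show "\<exists>a. hook_at a (a + int L) \<nu> \<rho>" using h by metis
next
  assume "\<exists>a. hook_at a (a + int L) \<nu> \<rho>"
  then obtain a where h: "hook_at a (a + int L) \<nu> \<rho>" by blast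
  then have "hook_length \<nu> \<rho> = L" using hook_at_card by fastforce
  moreover obtain r t where "strip \<nu> \<rho> r t" using hook_at_strip[OF h] by blast
  ultimately show "is_rim_hook L \<nu> \<rho>"
    using strip_imp_rim_hook by (metis hook_length_def)
qed

text \<open>A candidate in the definite description must be a one of \<nu> and a zero of \<rho>;
  only \<open>a\<close> is both.\<close>

lemma hook_at_hook_pos:
  assumes "hook_at a b \<nu> \<rho>"
  shows "hook_pos \<nu> \<rho> = a"
proof -
  have Z: "a < b" "a \<notin> zeros \<nu>" "b \<in> zeros \<nu>" "zeros \<rho> = insert a (zeros \<nu> - {b})"
    using assms by (auto simp: hook_at_def)
  have L: "int (hook_length \<nu> \<rho>) = b - a" by (rule hook_at_card[OF assms])
  have zo: "zo_seq \<rho> = zo_seq \<nu> \<circ> transpose c d \<longleftrightarrow> (\<forall>j. j \<in> zeros \<rho> \<longleftrightarrow> transpose c d j \<in> zeros \<nu>)" for c d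
  proof -
    have "zo_seq \<rho> j = zo_seq \<nu> i \<longleftrightarrow> (j \<in> zeros \<rho> \<longleftrightarrow> i \<in> zeros \<nu>)" for i j
      by (simp add: zo_seq_def zeros_def)
    then show ?thesis by (simp add: fun_eq_iff)
  qed
  show ?thesis
    unfolding hook_pos_def
  proof (rule the_equality)
    show "let d = a + int (hook_length \<nu> \<rho>) in
        zo_seq \<nu> a = 1 \<and> zo_seq \<nu> d = 0 \<and> zo_seq \<rho> = zo_seq \<nu> \<circ> transpose a d"
      unfolding L zo Let_def zo_seq_eq_0_iff zo_seq_eq_1_iff using Z by (auto simp: transpose_def)
    fix c assume "let d = c + int (hook_length \<nu> \<rho>) in
        zo_seq \<nu> c = 1 \<and> zo_seq \<nu> d = 0 \<and> zo_seq \<rho> = zo_seq \<nu> \<circ> transpose c d"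
    then have "c \<notin> zeros \<nu>" "c \<in> zeros \<rho>"
      unfolding L zo Let_def zo_seq_eq_0_iff zo_seq_eq_1_iff by (auto simp: transpose_def)
    then show "c = a" using Z by auto
  qed
qed

section \<open>The permutation of positions along a chain\<close>

text \<open>The smaller shape comes first, as in a tableau. Equal shapes, which stem from entries 0
  of the type or from unchanged quotient components, give the identity.\<close>

definition hook_swap :: "nat list \<Rightarrow> nat list \<Rightarrow> int \<Rightarrow> int" where
  "hook_swap \<rho> \<nu> = (if \<nu> = \<rho> then id
     else transpose (hook_pos \<nu> \<rho>) (hook_pos \<nu> \<rho> + int (hook_length \<nu> \<rho>)))"

fun chain_perm :: "nat list list \<Rightarrow> int \<Rightarrow> int" where
  "chain_perm (\<rho> # \<nu> # T) = chain_perm (\<nu> # T) \<circ> hook_swap \<rho> \<nu>"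
| "chain_perm _ = id"

text \<open>Each move composes the labelling with an interchange on the right. The pair at the head
  of the chain is processed last and so becomes the innermost factor: a place of the first shape is
  followed upwards to the last shape, where its label is read.\<close>

lemma final_labels_eq: "final_labels T = initial_labels (last T) \<circ> chain_perm T"
proof -
  have "fold (\<lambda>(\<rho>, \<nu>). move_labels \<nu> \<rho>) (rev (zip T (tl T))) f = f \<circ> chain_perm T" for f
    by (induction T rule: induct_list012) (auto simp: move_labels_def hook_swap_def)
  then show ?thesis by (simp add: final_labels_def)
qed

lemma hook_swap_eq:
  assumes "hook_at a b \<nu> \<rho>"
  shows "hook_swap \<rho> \<nu> = transpose a b"
proof -
  have "\<nu> \<noteq> \<rho>" using assms by (auto simp: hook_at_def)
  then show ?thesis
    using hook_at_hook_pos[OF assms] hook_at_card[OF assms] by (simp add: hook_swap_def)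
qed

text \<open>For \<open>k = 1\<close> the divisibility says nothing, which is the case that fits
  chains of quotient components.\<close>

definition hook_step :: "nat \<Rightarrow> nat list \<Rightarrow> nat list \<Rightarrow> bool" where
  "hook_step k \<rho> \<nu> \<longleftrightarrow> is_partition \<rho> \<and> is_partition \<nu> \<and>
     (\<nu> = \<rho> \<or> (\<exists>a b. hook_at a b \<nu> \<rho> \<and> int k dvd b - a))"

lemma hook_step_cases:
  assumes "hook_step k \<rho> \<nu>"
  obtains "\<nu> = \<rho>" "hook_swap \<rho> \<nu> = id"
  | a b where "hook_at a b \<nu> \<rho>" "int k dvd b - a" "hook_swap \<rho> \<nu> = transpose a b"
proof (cases "\<nu> = \<rho>")
  case True
  then show thesis using that(1) by (simp add: hook_swap_def)
next
  case False
  then obtain a b where "hook_at a b \<nu> \<rho>" "int k dvd b - a"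
    using assms unfolding hook_step_def by blast
  then show thesis using that(2) hook_swap_eq by blast
qed

lemma rim_hook_imp_hook_step:
  assumes "is_rim_hook L \<nu> \<rho>" "k dvd L"
  shows "hook_step k \<rho> \<nu>"
proof -
  obtain a where a: "hook_at a (a + int L) \<nu> \<rho>" using assms rim_hook_iff_hook_at by blast
  then have "is_partition \<rho>" "is_partition \<nu>" by (auto simp: hook_at_def)
  moreover have "int k dvd (a + int L) - a" using assms by simp
  ultimately show ?thesis using a unfolding hook_step_def by blast
qed

lemma chain_perm_zeros:
  assumes "successively (hook_step k) T" "T \<noteq> []"
  shows "bij (chain_perm T)" "chain_perm T ` zeros (hd T) = zeros (last T)"
proof -
  have "bij (chain_perm T) \<and> chain_perm T ` zeros (hd T) = zeros (last T)"
    using assms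
  proof (induction T rule: induct_list012)
    case (3 \<rho> \<nu> T)
    have IH: "bij (chain_perm (\<nu> # T))" "chain_perm (\<nu> # T) ` zeros \<nu> = zeros (last (\<nu> # T))"
      using 3 by auto
    have "hook_step k \<rho> \<nu>" using 3 by simp
    then have "bij (hook_swap \<rho> \<nu>) \<and> hook_swap \<rho> \<nu> ` zeros \<rho> = zeros \<nu>"
    proof (cases rule: hook_step_cases)
      case (2 a b)
      then have "a < b" "a \<notin> zeros \<nu>" "b \<in> zeros \<nu>" "zeros \<rho> = insert a (zeros \<nu> - {b})"
        by (auto simp: hook_at_def)
      then have "transpose a b ` zeros \<rho> = zeros \<nu>"
        by (auto simp: image_iff transpose_def)
      then show ?thesis using 2 by simp
    qed simp
    then have sw: "bij (hook_swap \<rho> \<nu>)" "hook_swap \<rho> \<nu> ` zeros \<rho> = zeros \<nu>" by auto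
    have "bij (chain_perm (\<rho> # \<nu> # T))" using bij_comp[OF sw(1) IH(1)] by simp
    moreover have "chain_perm (\<rho> # \<nu> # T) ` zeros \<rho> = zeros (last (\<nu> # T))"
      unfolding chain_perm.simps image_comp[symmetric] sw(2) IH(2) ..
    ultimately show ?case by (simp del: chain_perm.simps)
  qed auto
  then show "bij (chain_perm T)" "chain_perm T ` zeros (hd T) = zeros (last T)" by auto
qed

text \<open>Removing a hook brings a zero to a place that carried a one. If only zeros occur up to
  \<open>x\<close>, all such places lie right of \<open>x\<close>, and the ray is never
  touched.\<close>

lemma chain_perm_fixes:
  assumes "successively (hook_step k) T" "T \<noteq> []" "{..x} \<subseteq> zeros (last T)"
  shows "{..x} \<subseteq> zeros (hd T)" "y \<le> x \<Longrightarrow> chain_perm T y = y"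
proof -
  have "{..x} \<subseteq> zeros (hd T) \<and> (\<forall>y\<le>x. chain_perm T y = y)"
    using assms
  proof (induction T rule: induct_list012)
    case (3 \<rho> \<nu> T)
    have IH: "{..x} \<subseteq> zeros \<nu>" "\<forall>y\<le>x. chain_perm (\<nu> # T) y = y"
      using 3 by auto
    have "hook_step k \<rho> \<nu>" using 3 by simp
    then have "{..x} \<subseteq> zeros \<rho> \<and> (\<forall>y\<le>x. hook_swap \<rho> \<nu> y = y)"
    proof (cases rule: hook_step_cases)
      case (2 a b)
      then have ab: "a < b" "a \<notin> zeros \<nu>" "b \<in> zeros \<nu>" "zeros \<rho> = insert a (zeros \<nu> - {b})"
        by (auto simp: hook_at_def)
      then have "x < a" using IH(1) by (meson atMost_iff not_le subsetD)
      then show ?thesis using ab 2 IH(1) by (auto simp: transpose_def)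
    qed (use IH in simp)
    then show ?case using IH by simp
  qed auto
  then show "{..x} \<subseteq> zeros (hd T)" "y \<le> x \<Longrightarrow> chain_perm T y = y" by auto
qed

lemma chain_perm_mono_on_class:
  assumes "successively (\<lambda>\<rho> \<nu>. is_rim_hook k \<nu> \<rho>) T"
    and "x \<in> zeros (hd T)" "y \<in> zeros (hd T)" "x < y" "int k dvd y - x"
  shows "chain_perm T x < chain_perm T y"
  using assms
proof (induction T arbitrary: x y rule: induct_list012)
  case (3 \<rho> \<nu> T)
  have "is_rim_hook k \<nu> \<rho>" using 3 by simp
  then obtain a where a: "hook_at a (a + int k) \<nu> \<rho>" using rim_hook_iff_hook_at by blast
  then have k: "k > 0" and ab: "a \<notin> zeros \<nu>" "a + int k \<in> zeros \<nu>"
      "zeros \<rho> = insert a (zeros \<nu> - {a + int k})"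
    by (auto simp: hook_at_def)
  let ?t = "transpose a (a + int k)"
  have sw: "hook_swap \<rho> \<nu> = ?t" using hook_swap_eq[OF a] .
  have xy: "x \<in> zeros \<rho>" "y \<in> zeros \<rho>" using 3 by auto
  have ne: "x \<noteq> a + int k" "y \<noteq> a + int k" using xy ab k by auto
  \<comment> \<open>Distinct congruent places differ by at least \<open>k\<close>. So a zero moved
    from \<open>x = a\<close> to \<open>a + k\<close> could at most meet \<open>y\<close>, but
    \<open>y\<close> is a zero of \<rho> and \<open>a + k\<close> is a one of \<rho>.\<close>
  have far: "x + int k \<le> y" using 3 zdvd_imp_le[of "int k" "y - x"] by auto
  have tx: "?t x \<in> zeros \<nu>" "?t y \<in> zeros \<nu>" using xy ab ne by (auto simp: transpose_def)
  have lt: "?t x < ?t y" using far ne 3 k by (auto simp: transpose_def)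
  have "int k dvd ?t y - ?t x"
    using 3(7) ne by (auto simp: transpose_def dvd_add_right_iff algebra_simps dvd_diff_commute)
  then show ?case using 3(2)[of "?t x" "?t y"] 3(3) tx lt sw by simp
qed auto

section \<open>Runners and the quotient\<close>

definition runner :: "nat \<Rightarrow> nat \<Rightarrow> int set \<Rightarrow> int set" where
  "runner k i S = {j. int i + int k * j \<in> S}"

text \<open>Divisibility puts \<open>a\<close> and \<open>b\<close> both on a given runner or both
  off it. The runner therefore sees either nothing or a single interchange, with the distance
  divided by \<open>k\<close>.\<close>

lemma hook_at_runner:
  assumes "hook_at a b \<nu> \<rho>" "int k dvd b - a" "0 < k"
  obtains "\<And>j. int i + int k * j \<noteq> a" "\<And>j. int i + int k * j \<noteq> b"
      "runner k i (zeros \<nu>) = runner k i (zeros \<rho>)"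
  | a' b' where "a = int i + int k * a'" "b = int i + int k * b'" "a' < b'"
      "a' \<notin> runner k i (zeros \<nu>)" "b' \<in> runner k i (zeros \<nu>)"
      "runner k i (zeros \<rho>) = insert a' (runner k i (zeros \<nu>) - {b'})"
proof -
  have Z: "a < b" "a \<notin> zeros \<nu>" "b \<in> zeros \<nu>" "zeros \<rho> = insert a (zeros \<nu> - {b})"
    using assms by (auto simp: hook_at_def)
  obtain d where d: "b = a + int k * d" using assms(2) by (metis dvdE add_diff_cancel_left' diff_add_cancel add.commute)
  show thesis
  proof (cases "\<exists>a'. a = int i + int k * a'")
    case True
    then obtain a' where a': "a = int i + int k * a'" by blast
    then have b': "b = int i + int k * (a' + d)" using d by (simp add: algebra_simps)
    have "a' < a' + d" using Z(1) d assms(3) by (simp add: zero_less_mult_iff)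
    moreover have "runner k i (zeros \<rho>) = insert a' (runner k i (zeros \<nu>) - {a' + d})"
      unfolding runner_def Z(4) a' b' using assms(3) by auto
    ultimately show thesis using Z a' b' by (intro that(2)[of a' "a' + d"]) (auto simp: runner_def)
  next
    case False
    then have na: "int i + int k * j \<noteq> a" for j by auto
    have nb: "int i + int k * j \<noteq> b" for j
    proof
      assume "int i + int k * j = b"
      then have "int i + int k * (j - d) = a" using d by (simp add: algebra_simps)
      then show False using na by blast
    qed
    have "runner k i (zeros \<nu>) = runner k i (zeros \<rho>)"
      unfolding runner_def Z(4) using na nb by auto
    then show thesis using that(1) na nb by blast
  qed
qed

lemma has_charge_runner_down:
  assumes "hook_at a b \<nu> \<rho>" "int k dvd b - a" "0 < k" "has_charge (runner k i (zeros \<nu>)) c"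
  shows "has_charge (runner k i (zeros \<rho>)) c"
proof (rule hook_at_runner[OF assms(1-3), of i])
  assume "runner k i (zeros \<nu>) = runner k i (zeros \<rho>)"
  then show ?thesis using assms(4) by simp
next
  fix a' b' assume "a' \<notin> runner k i (zeros \<nu>)" "b' \<in> runner k i (zeros \<nu>)"
    "runner k i (zeros \<rho>) = insert a' (runner k i (zeros \<nu>) - {b'})"
  then show ?thesis by (rule has_charge_exchange[OF assms(4)])
qed

lemma has_charge_runner_up:
  assumes "hook_at a b \<nu> \<rho>" "int k dvd b - a" "0 < k" "has_charge (runner k i (zeros \<rho>)) c"
  shows "has_charge (runner k i (zeros \<nu>)) c"
proof (rule hook_at_runner[OF assms(1-3), of i])
  assume "runner k i (zeros \<nu>) = runner k i (zeros \<rho>)"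
  then show ?thesis using assms(4) by simp
next
  fix a' b' assume r: "a' < b'" "a' \<notin> runner k i (zeros \<nu>)" "b' \<in> runner k i (zeros \<nu>)"
    "runner k i (zeros \<rho>) = insert a' (runner k i (zeros \<nu>) - {b'})"
  show ?thesis
    by (rule has_charge_exchange[OF assms(4), of b' a']) (use r in auto)
qed

lemma ex_has_charge_runner:
  assumes "has_charge S d" "0 < k"
  obtains c where "has_charge (runner k i S) c"
proof -
  obtain N where N: "{..N} \<subseteq> S" "finite (S \<inter> {N<..})"
    using assms unfolding has_charge_def by blast
  \<comment> \<open>Since \<open>M \<le> 0\<close> and \<open>k \<ge> 1\<close>, this choice gives
    \<open>i + k * M \<le> i + M = - \<bar>N\<bar> \<le> N\<close>.\<close>
  define M where "M = - (\<bar>N\<bar> + int i)"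
  have "int k * M \<le> 1 * M" using assms(2) by (intro mult_right_mono_neg) (auto simp: M_def)
  then have M: "int i + int k * M \<le> N" by (simp add: M_def)
  note L = has_charge_lower[OF N M]
  have "j \<in> runner k i S" if "j \<le> M" for j
  proof -
    have "int i + int k * j \<le> int i + int k * M" using that by (simp add: mult_left_mono)
    then show ?thesis using L(1) by (auto simp: runner_def)
  qed
  then have "{..M} \<subseteq> runner k i S" by auto
  moreover have "finite (runner k i S \<inter> {M<..})"
  proof (rule inj_on_finite)
    show "inj_on (\<lambda>j. int i + int k * j) (runner k i S \<inter> {M<..})"
      using assms(2) by (auto simp: inj_on_def)
    show "(\<lambda>j. int i + int k * j) ` (runner k i S \<inter> {M<..}) \<subseteq> S \<inter> {int i + int k * M<..}"
      using assms(2) by (auto simp: runner_def)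
  qed (rule L(2))
  ultimately show thesis using that unfolding has_charge_def by blast
qed

lemma runner_zeros_Nil:
  assumes "i \<in> {1..k}"
  shows "runner k i (zeros []) = {..-1}"
proof -
  have "int i + int k * j \<le> 0 \<longleftrightarrow> j \<le> -1" for j
  proof
    assume le: "int i + int k * j \<le> 0"
    show "j \<le> -1"
    proof (rule ccontr)
      assume "\<not> j \<le> -1"
      then have "0 \<le> int k * j" by simp
      then show False using le assms by simp
    qed
  next
    assume "j \<le> -1"
    then have "int k * j \<le> int k * (-1)" by (intro mult_left_mono) auto
    then show "int i + int k * j \<le> 0" using assms by simp
  qed
  then show ?thesis by (auto simp: runner_def zeros_Nil)
qed

text \<open>The charges are those of the empty partition. All equal -1, since residues are
  represented by 1 to \<open>k\<close> while the zeros of \<open>[]\<close> are the nonpositive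
  places.\<close>

definition balanced :: "nat \<Rightarrow> nat list \<Rightarrow> bool" where
  "balanced k \<nu> \<longleftrightarrow> is_partition \<nu> \<and> (\<forall>i\<in>{1..k}. has_charge (runner k i (zeros \<nu>)) (-1))"

lemma balanced_Nil: "balanced k []"
proof -
  have "has_charge {..-1} (-1)"
  proof -
    have "{..- 1} \<inter> {- 1<..} = ({} :: int set)" by auto
    then show ?thesis unfolding has_charge_def by (intro exI[of _ "-1"]) simp
  qed
  then show ?thesis by (simp add: balanced_def is_partition_def runner_zeros_Nil)
qed

lemma balanced_step:
  assumes "balanced k \<rho>" "hook_step k \<rho> \<nu>" "0 < k"
  shows "balanced k \<nu>"
  using assms(2)
proof (cases rule: hook_step_cases)
  case 1
  then show ?thesis using assms by simp
next
  case (2 a b)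
  then show ?thesis
    using has_charge_runner_up[OF 2(1,2) assms(3)] assms(1) by (auto simp: balanced_def hook_at_def)
qed

lemma quot_zeros:
  assumes "balanced k \<nu>" "i \<in> {1..k}"
  shows "is_partition (quot k \<nu> i)" "zeros (quot k \<nu> i) = {j. j - 1 \<in> runner k i (zeros \<nu>)}"
proof -
  have s: "zo_seq \<nu> x = 0 \<or> zo_seq \<nu> x = 1" for x by (simp add: zo_seq_def)
  have S: "runner k i (zeros \<nu>) = {j. zo_seq \<nu> (int i + int k * j) = 0}"
    by (simp add: runner_def zo_seq_eq_0_iff)
  have ch: "has_charge (runner k i (zeros \<nu>)) (-1)" using assms by (simp add: balanced_def)
  show "is_partition (quot k \<nu> i)" "zeros (quot k \<nu> i) = {j. j - 1 \<in> runner k i (zeros \<nu>)}"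
    using partition_of_seq_zeros[OF _ S ch] s by (simp_all add: quot_def)
qed

text \<open>The embedding of \<open>j\<close> as \<open>i + k * (j - 1)\<close> intertwines the
  interchange in the component with that in the shape; a hook off the runner moves no place in its
  image.\<close>

lemma quot_step:
  assumes "balanced k \<rho>" "hook_step k \<rho> \<nu>" "i \<in> {1..k}"
  shows "hook_step 1 (quot k \<rho> i) (quot k \<nu> i)"
    and "int i + int k * (hook_swap (quot k \<rho> i) (quot k \<nu> i) j - 1) =
      hook_swap \<rho> \<nu> (int i + int k * (j - 1))"
proof -
  have k: "0 < k" using assms by simp
  note Q\<rho> = quot_zeros[OF assms(1,3)]
  note Q\<nu> = quot_zeros[OF balanced_step[OF assms(1,2) k] assms(3)]
  have "hook_step 1 (quot k \<rho> i) (quot k \<nu> i) \<and>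
    (\<forall>j. int i + int k * (hook_swap (quot k \<rho> i) (quot k \<nu> i) j - 1) =
      hook_swap \<rho> \<nu> (int i + int k * (j - 1)))"
    using assms(2)
  proof (cases rule: hook_step_cases)
    case 1
    then show ?thesis using Q\<rho> by (simp add: hook_step_def hook_swap_def)
  next
    case (2 a b)
    show ?thesis
    proof (rule hook_at_runner[OF 2(1,2) k, of i])
      assume n: "\<And>j. int i + int k * j \<noteq> a" "\<And>j. int i + int k * j \<noteq> b"
        and eq: "runner k i (zeros \<nu>) = runner k i (zeros \<rho>)"
      have "quot k \<nu> i = quot k \<rho> i" using zeros_inject[OF Q\<nu>(1) Q\<rho>(1)] Q\<nu>(2) Q\<rho>(2) eq by simp
      then show ?thesis using Q\<rho> 2(3) n by (simp add: hook_step_def hook_swap_def transpose_def)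
    next
      fix a' b' assume r: "a = int i + int k * a'" "b = int i + int k * b'" "a' < b'"
        "a' \<notin> runner k i (zeros \<nu>)" "b' \<in> runner k i (zeros \<nu>)"
        "runner k i (zeros \<rho>) = insert a' (runner k i (zeros \<nu>) - {b'})"
      have h: "hook_at (a' + 1) (b' + 1) (quot k \<nu> i) (quot k \<rho> i)"
      proof -
        have "{j. j - 1 \<in> insert a' (R - {b'})} = insert (a' + 1) ({j. j - 1 \<in> R} - {b' + 1})" for R
          by (auto simp: diff_eq_eq)
        then show ?thesis
          unfolding hook_at_def Q\<nu>(2) Q\<rho>(2) r(6) using r(3-5) Q\<nu>(1) Q\<rho>(1) by simp
      qed
      have "int i + int k * (transpose (a' + 1) (b' + 1) j - 1) = transpose a b (int i + int k * (j - 1))" for j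
        unfolding r(1,2) using k by (auto simp: transpose_def)
      then show ?thesis
        using h hook_swap_eq[OF h] 2(3) Q\<nu>(1) Q\<rho>(1) unfolding hook_step_def by auto
    qed
  qed
  then show "hook_step 1 (quot k \<rho> i) (quot k \<nu> i)"
    and "int i + int k * (hook_swap (quot k \<rho> i) (quot k \<nu> i) j - 1) =
      hook_swap \<rho> \<nu> (int i + int k * (j - 1))" by blast+
qed

section \<open>Transfer of whole chains to the runners\<close>

lemma chain_perm_remdups_adj: "chain_perm (remdups_adj T) = chain_perm T"
proof (induction T rule: remdups_adj.induct)
  case (3 x y xs)
  show ?case
  proof (cases "x = y")
    case True
    then show ?thesis using 3(1) by (simp add: hook_swap_def)
  next
    case False
    obtain zs where zs: "remdups_adj (y # xs) = y # zs" by (metis remdups_adj_Cons' list.exhaust_sel remdups_adj.simps(2))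
    then show ?thesis using 3(2) False by simp
  qed
qed auto

lemma balanced_chain:
  assumes "successively (hook_step k) T" "T \<noteq> []" "balanced k (hd T)" "i \<in> {1..k}"
  shows "balanced k (last T)"
    and "successively (hook_step 1) (map (\<lambda>\<nu>. quot k \<nu> i) T)"
    and "int i + int k * (chain_perm (map (\<lambda>\<nu>. quot k \<nu> i) T) j - 1) =
      chain_perm T (int i + int k * (j - 1))"
proof -
  have "balanced k (last T) \<and> successively (hook_step 1) (map (\<lambda>\<nu>. quot k \<nu> i) T) \<and>
    (\<forall>j. int i + int k * (chain_perm (map (\<lambda>\<nu>. quot k \<nu> i) T) j - 1) =
      chain_perm T (int i + int k * (j - 1)))"
    using assms
  proof (induction T rule: induct_list012)
    case (3 \<rho> \<nu> T)
    have \<rho>: "balanced k \<rho>" "hook_step k \<rho> \<nu>" "0 < k" using 3 by auto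
    have "balanced k \<nu>" by (rule balanced_step[OF \<rho>])
    then show ?case using 3 quot_step[OF \<rho>(1,2) assms(4)] by simp
  qed auto
  then show "balanced k (last T)" "successively (hook_step 1) (map (\<lambda>\<nu>. quot k \<nu> i) T)"
     "int i + int k * (chain_perm (map (\<lambda>\<nu>. quot k \<nu> i) T) j - 1) =
      chain_perm T (int i + int k * (j - 1))" by blast+
qed

section \<open>Cores\<close>

lemma card_diagram: "card (diagram \<nu>) = sum_list \<nu>" "finite (diagram \<nu>)"
proof -
  have eq: "diagram \<nu> = Sigma {1..length \<nu>} (\<lambda>i. {1..part \<nu> i})"
    by (auto simp: diagram_def part_def split: if_splits)
  have "card (diagram \<nu>) = (\<Sum>i\<in>{1..length \<nu>}. part \<nu> i)"
    unfolding eq by simp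
  also have "\<dots> = (\<Sum>i\<in>{0..<length \<nu>}. part \<nu> (Suc i))"
    by (simp add: sum.atLeast1_atMost_eq lessThan_atLeast0)
  also have "\<dots> = sum_list \<nu>" by (simp add: sum_list_sum_nth part_def)
  finally show "card (diagram \<nu>) = sum_list \<nu>" .
  show "finite (diagram \<nu>)" unfolding eq by simp
qed

lemma rim_hook_sum_list:
  assumes "is_rim_hook L \<nu> \<rho>"
  shows "sum_list \<nu> = sum_list \<rho> + L"
proof -
  have "diagram \<rho> \<subseteq> diagram \<nu>" "card (diagram \<nu> - diagram \<rho>) = L"
    using assms by (auto simp: is_rim_hook_def)
  then show ?thesis
    using card_Diff_subset[of "diagram \<rho>" "diagram \<nu>"] card_mono[of "diagram \<nu>" "diagram \<rho>"]
      card_diagram[of \<nu>] card_diagram[of \<rho>] by simp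
qed

text \<open>Moving one zero keeps the charge 0, so the partition read off the changed sequence has
  exactly the changed zeros, without a shift.\<close>

lemma ex_hook_at:
  assumes "is_partition \<nu>" "a \<notin> zeros \<nu>" "b \<in> zeros \<nu>" "a < b"
  obtains \<rho> where "hook_at a b \<nu> \<rho>"
proof -
  define S where "S = insert a (zeros \<nu> - {b})"
  have ch: "has_charge S 0"
    using has_charge_exchange[OF has_charge_zeros[OF assms(1)] assms(2,3)] S_def by simp
  define s where "s = (\<lambda>j. if j \<in> S then 0 else 1 :: nat)"
  have s: "s j = 0 \<or> s j = 1" "S = {j. s j = 0}" for j by (auto simp: s_def)
  have "is_partition (partition_of_seq s)" "zeros (partition_of_seq s) = S"
    using partition_of_seq_zeros[OF s ch] by simp_all
  then have "hook_at a b \<nu> (partition_of_seq s)" using assms unfolding hook_at_def S_def by blast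
  then show thesis by (rule that)
qed

text \<open>The abacus argument: removals preserve the charge of every runner, and where no
  \<open>k\<close>-hook can be removed each runner is down-closed, hence determined by its charge.
  This makes the description in \<open>k_core\<close> definite.\<close>

lemma k_core_unique:
  assumes "is_partition \<nu>" "0 < k"
    and \<kappa>: "(is_rim_hook k)\<^sup>*\<^sup>* \<nu> \<kappa>" "\<nexists>\<rho>. is_rim_hook k \<kappa> \<rho>"
    and \<kappa>': "(is_rim_hook k)\<^sup>*\<^sup>* \<nu> \<kappa>'" "\<nexists>\<rho>. is_rim_hook k \<kappa>' \<rho>"
  shows "\<kappa> = \<kappa>'"
proof -
  have inv: "is_partition \<tau> \<and> (\<forall>i c. has_charge (runner k i (zeros \<nu>)) c \<longrightarrow> has_charge (runner k i (zeros \<tau>)) c)"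
    if "(is_rim_hook k)\<^sup>*\<^sup>* \<nu> \<tau>" for \<tau>
    using that
  proof (induction rule: rtranclp_induct)
    case (step \<tau> \<sigma>)
    then obtain a where a: "hook_at a (a + int k) \<tau> \<sigma>" using rim_hook_iff_hook_at by blast
    show ?case using step has_charge_runner_down[OF a _ assms(2)] a by (simp add: hook_at_def)
  qed (use assms in simp)
  have down: "j - 1 \<in> runner k i (zeros \<tau>)"
    if \<tau>: "is_partition \<tau>" "\<nexists>\<rho>. is_rim_hook k \<tau> \<rho>" "j \<in> runner k i (zeros \<tau>)" for \<tau> i j
  proof (rule ccontr)
    let ?a = "int i + int k * (j - 1)"
    assume "j - 1 \<notin> runner k i (zeros \<tau>)"
    then have "?a \<notin> zeros \<tau>" "?a + int k \<in> zeros \<tau>" "?a < ?a + int k"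
      using \<tau>(3) assms(2) by (auto simp: runner_def algebra_simps)
    then obtain \<rho> where "hook_at ?a (?a + int k) \<tau> \<rho>" using ex_hook_at[OF \<tau>(1)] by blast
    then show False using \<tau>(2) rim_hook_iff_hook_at by blast
  qed
  note I = inv[OF \<kappa>(1)] and I' = inv[OF \<kappa>'(1)]
  have R: "runner k i (zeros \<kappa>) = runner k i (zeros \<kappa>')" for i
  proof -
    obtain c where "has_charge (runner k i (zeros \<nu>)) c"
      using ex_has_charge_runner[OF has_charge_zeros[OF assms(1)] assms(2)] by blast
    then have "has_charge (runner k i (zeros \<kappa>)) c" "has_charge (runner k i (zeros \<kappa>')) c"
      using I I' by auto
    then show ?thesis
      by (rule down_closed_charge_unique)
        (use down[of \<kappa>] down[of \<kappa>'] I I' \<kappa>(2) \<kappa>'(2) in simp_all)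
  qed
  have "x \<in> zeros \<kappa> \<longleftrightarrow> x \<in> zeros \<kappa>'" for x
  proof -
    \<comment> \<open>Here residues are represented by 0 to \<open>k - 1\<close> instead of 1 to
      \<open>k\<close>; \<open>runner\<close> accepts any representative.\<close>
    have "x = int (nat (x mod int k)) + int k * (x div int k)" using assms(2) by simp
    then have "x \<in> S \<longleftrightarrow> x div int k \<in> runner k (nat (x mod int k)) S" for S
      by (simp add: runner_def)
    then show ?thesis using R by blast
  qed
  then show ?thesis using zeros_inject[of \<kappa> \<kappa>'] I I' by blast
qed

lemma k_core_reachable:
  assumes "is_partition \<nu>" "0 < k"
  shows "(is_rim_hook k)\<^sup>*\<^sup>* \<nu> (k_core k \<nu>)"
proof -
  have "\<exists>\<kappa>. (is_rim_hook k)\<^sup>*\<^sup>* \<nu> \<kappa> \<and> \<not> (\<exists>\<rho>. is_rim_hook k \<kappa> \<rho>)"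
  proof (induction "sum_list \<nu>" arbitrary: \<nu> rule: less_induct)
    case less
    show ?case
    proof (cases "\<exists>\<rho>. is_rim_hook k \<nu> \<rho>")
      case True
      then obtain \<rho> where \<rho>: "is_rim_hook k \<nu> \<rho>" by blast
      then have "sum_list \<rho> < sum_list \<nu>" using rim_hook_sum_list[OF \<rho>] assms(2) by simp
      then show ?thesis using less[of \<rho>] \<rho> by (meson converse_rtranclp_into_rtranclp)
    qed blast
  qed
  then have "\<exists>!\<kappa>. (is_rim_hook k)\<^sup>*\<^sup>* \<nu> \<kappa> \<and> \<not> (\<exists>\<rho>. is_rim_hook k \<kappa> \<rho>)"
    using k_core_unique[OF assms] by blast
  from theI'[OF this] show ?thesis unfolding k_core_def by blast
qed

text \<open>Reversing the removals builds the chain upwards. \<open>T\<close> has one more member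
  than there are hooks, which accounts for the summand \<open>k\<close> on the left of the
  equation.\<close>

lemma rim_hook_chain:
  assumes "(is_rim_hook k)\<^sup>*\<^sup>* \<nu> \<kappa>" "is_partition \<kappa>"
  shows "\<exists>T. T \<noteq> [] \<and> hd T = \<kappa> \<and> last T = \<nu> \<and> (\<forall>\<rho>\<in>set T. is_partition \<rho>) \<and>
    successively (\<lambda>\<rho> \<nu>. is_rim_hook k \<nu> \<rho>) T \<and> sum_list \<nu> + k = sum_list \<kappa> + k * length T"
  using assms(1)
proof (induction rule: converse_rtranclp_induct)
  case base
  show ?case using assms(2) by (intro exI[of _ "[\<kappa>]"]) simp
next
  case (step \<nu> \<tau>)
  then obtain T where "T \<noteq> []" "hd T = \<kappa>" "last T = \<tau>" "\<forall>\<rho>\<in>set T. is_partition \<rho>"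
    "successively (\<lambda>\<rho> \<nu>. is_rim_hook k \<nu> \<rho>) T" "sum_list \<tau> + k = sum_list \<kappa> + k * length T" by blast
  then show ?case
    using step.hyps(1) rim_hook_sum_list[OF step.hyps(1)]
    by (intro exI[of _ "T @ [\<nu>]"]) (auto simp: successively_append_iff is_rim_hook_def)
qed

lemma ex_RHT_replicate:
  assumes "is_partition \<nu>" "k_core k \<nu> = []" "0 < k"
  shows "RHT \<nu> (replicate (sum_list \<nu> div k) k) \<noteq> {}"
proof -
  obtain T where T: "T \<noteq> []" "hd T = []" "last T = \<nu>" "\<forall>\<rho>\<in>set T. is_partition \<rho>"
      "successively (\<lambda>\<rho> \<nu>. is_rim_hook k \<nu> \<rho>) T" "sum_list \<nu> + k = k * length T"
    using rim_hook_chain[OF k_core_reachable[OF assms(1,3)]] assms(2)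
    by (auto simp: is_partition_def)
  obtain n where n: "length T = Suc n" using T(1) by (cases T) auto
  then have sum: "sum_list \<nu> = k * n" using T(6) by simp
  then have "T \<in> RHT \<nu> (replicate (sum_list \<nu> div k) k)"
    unfolding RHT_def using T n assms(3)
    by (auto simp: sum_list_replicate successively_conv_nth)
  then show ?thesis by blast
qed

section \<open>The zero permutation\<close>

lemma rank_inject:
  fixes Z :: "int set"
  assumes "finite Z" "x \<in> Z" "y \<in> Z" "card {z \<in> Z. z \<le> x} = card {z \<in> Z. z \<le> y}"
  shows "x = y"
proof -
  have "\<not> u < v" if "u \<in> Z" "v \<in> Z" "card {z \<in> Z. z \<le> u} = card {z \<in> Z. z \<le> v}" for u v
  proof
    assume "u < v"
    then have "{z \<in> Z. z \<le> u} \<subseteq> {z \<in> Z. z \<le> v}"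
      "v \<in> {z \<in> Z. z \<le> v}" "v \<notin> {z \<in> Z. z \<le> u}" using that by auto
    then have "{z \<in> Z. z \<le> u} \<subset> {z \<in> Z. z \<le> v}" by blast
    then have "card {z \<in> Z. z \<le> u} < card {z \<in> Z. z \<le> v}"
      using assms(1) by (intro psubset_card_mono) auto
    then show False using that by simp
  qed
  then show ?thesis using assms by (metis linorder_neqE)
qed

lemma initial_labels_eq:
  assumes "is_partition \<nu>"
  defines "Z \<equiv> zeros \<nu> - {..- int (length \<nu>)}"
  shows "initial_labels \<nu> j = (if j \<in> Z then card {z \<in> Z. z \<le> j} else 0)"
  unfolding initial_labels_def labelled_zeros(1)[OF assms(1)] Z_def Let_def ..

text \<open>A common frame for \<open>T\<close> and \<open>T'\<close>, with the given
  \<open>k\<close>, and for the components of both, with 1 in its place.\<close>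

locale chain =
  fixes k :: nat and T :: "nat list list"
  assumes steps: "successively (hook_step k) T" and nonempty: "T \<noteq> []" and hd_Nil: "hd T = []"
    and part_last: "is_partition (last T)"
begin

abbreviation "len \<equiv> length (last T)"

abbreviation "labelled \<equiv> zeros (last T) - {..- int len}"

lemma finite_labelled: "finite labelled" "card labelled = len"
  unfolding labelled_zeros(1)[OF part_last, symmetric] labelled_zeros(2)[OF part_last] by simp_all

lemma chain_perm_fixes_low: "y \<le> - int len \<Longrightarrow> chain_perm T y = y"
proof (rule chain_perm_fixes(2)[OF steps nonempty])
  show "{..- int len} \<subseteq> zeros (last T)" unfolding zeros_split[of "last T"] by (rule Un_upper1)
qed

text \<open>The nonpositive places are mapped onto all zeros of the last shape, and the ray up to
  \<open>- int len\<close> is fixed pointwise; taking it away on both sides leaves the labelled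
  zeros.\<close>

lemma bij_labelled: "bij_betw (chain_perm T) {- int len<..0} labelled"
proof -
  note inj = bij_is_inj[OF chain_perm_zeros(1)[OF steps nonempty]]
  have "{- int len<..0} = {..0} - {..- int len}" by auto
  then have "chain_perm T ` {- int len<..0} = chain_perm T ` {..0} - chain_perm T ` {..- int len}"
    by (simp add: image_set_diff[OF inj])
  also have "chain_perm T ` {..0} = zeros (last T)"
    using chain_perm_zeros(2)[OF steps nonempty] hd_Nil zeros_Nil by simp
  also have "chain_perm T ` {..- int len} = {..- int len}"
    using chain_perm_fixes_low by (simp add: image_def)
  finally show ?thesis using inj_on_subset[OF inj subset_UNIV] by (simp add: bij_betw_def)
qed

lemma labelled_mem: "q \<in> {1..len} \<Longrightarrow> chain_perm T (int q - int len) \<in> labelled"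
  by (rule bij_betwE[OF bij_labelled, rule_format]) auto

lemma zero_perm_eq:
  assumes "q \<in> {1..len}"
  shows "zero_perm T q = card {z \<in> labelled. z \<le> chain_perm T (int q - int len)}"
  using assms labelled_mem[OF assms]
  by (simp add: zero_perm_def Let_def final_labels_eq initial_labels_eq[OF part_last])

lemma zero_perm_permutes: "zero_perm T permutes {1..len}"
proof (rule bij_imp_permutes)
  have into: "zero_perm T q \<in> {1..len}" if q: "q \<in> {1..len}" for q
  proof -
    let ?S = "{z \<in> labelled. z \<le> chain_perm T (int q - int len)}"
    have "chain_perm T (int q - int len) \<in> ?S" using labelled_mem[OF q] by simp
    moreover have "finite ?S" by (rule finite_subset[OF _ finite_labelled(1)]) auto
    ultimately have "0 < card ?S" using card_gt_0_iff by blast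
    moreover have "card ?S \<le> card labelled" by (rule card_mono[OF finite_labelled(1)]) auto
    ultimately show ?thesis unfolding zero_perm_eq[OF q] using finite_labelled(2) by simp
  qed
  have "inj_on (zero_perm T) {1..len}"
  proof (rule inj_onI)
    fix x y assume xy: "x \<in> {1..len}" "y \<in> {1..len}" "zero_perm T x = zero_perm T y"
    then have "chain_perm T (int x - int len) = chain_perm T (int y - int len)"
      using rank_inject[OF finite_labelled(1) labelled_mem[OF xy(1)] labelled_mem[OF xy(2)]]
        zero_perm_eq by simp
    then show "x = y"
      using bij_is_inj[OF chain_perm_zeros(1)[OF steps nonempty]] by (simp add: inj_eq)
  qed
  then show "bij_betw (zero_perm T) {1..len} {1..len}"
    unfolding bij_betw_def
    by (intro conjI endo_inj_surj image_subsetI into) simp_all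
  show "zero_perm T q = q" if "q \<notin> {1..len}" for q using that by (auto simp: zero_perm_def Let_def)
qed

lemma zero_perm_mono:
  assumes "\<And>x y. x < y \<Longrightarrow> y \<le> 0 \<Longrightarrow> chain_perm T x < chain_perm T y"
  shows "zero_perm T q = q"
proof (cases "q \<in> {1..len}")
  case True
  let ?x = "int q - int len"
  have x: "- int len < ?x" "?x \<le> 0" using True by auto
  have le: "chain_perm T y \<le> chain_perm T ?x \<longleftrightarrow> y \<le> ?x" if "y \<le> 0" for y
    using assms[of y ?x] assms[of ?x y] that x by (cases y ?x rule: linorder_cases) auto
  have "{z \<in> labelled. z \<le> chain_perm T ?x} = chain_perm T ` {- int len<..?x}"
  proof -
    have "labelled = chain_perm T ` {- int len<..0}"
      using bij_labelled by (simp add: bij_betw_def)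
    then have "{z \<in> labelled. z \<le> chain_perm T ?x} =
        chain_perm T ` {y \<in> {- int len<..0}. chain_perm T y \<le> chain_perm T ?x}"
      by (simp only: Compr_image_eq)
    also have "{y \<in> {- int len<..0}. chain_perm T y \<le> chain_perm T ?x} = {- int len<..?x}"
      using le x by auto
    finally show ?thesis .
  qed
  moreover have "inj_on (chain_perm T) {- int len<..?x}"
    using bij_labelled x(2) by (auto simp: bij_betw_def intro: inj_on_subset)
  ultimately show ?thesis using zero_perm_eq[OF True] by (simp add: card_image)
next
  case False
  then show ?thesis by (auto simp: zero_perm_def Let_def)
qed

end

text \<open>Both permutations rank the zeros of the same shape, so equal ranks mean equal positions.
  Zero permutations can thus be compared without computing any rank.\<close>

lemma zero_perm_eq_iff:
  assumes "chain k T" "chain k' T'" "last T' = last T"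
    and "q \<in> {1..length (last T)}" "q' \<in> {1..length (last T)}"
  shows "zero_perm T q = zero_perm T' q' \<longleftrightarrow>
    chain_perm T (int q - int (length (last T))) = chain_perm T' (int q' - int (length (last T)))"
proof -
  interpret T: chain k T by (rule assms)
  interpret T': chain k' T' by (rule assms)
  let ?x = "chain_perm T (int q - int T.len)" and ?x' = "chain_perm T' (int q' - int T.len)"
  have "?x \<in> T.labelled" by (rule T.labelled_mem[OF assms(4)])
  moreover have "?x' \<in> T.labelled" using T'.labelled_mem[of q'] assms(3,5) by simp
  moreover have "zero_perm T q = card {z \<in> T.labelled. z \<le> ?x}"
    by (rule T.zero_perm_eq[OF assms(4)])
  moreover have "zero_perm T' q' = card {z \<in> T.labelled. z \<le> ?x'}"
    using T'.zero_perm_eq[of q'] assms(3,5) by simp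
  ultimately show ?thesis using rank_inject[OF T.finite_labelled(1), of ?x ?x'] by metis
qed

text \<open>Every runner of the empty partition is \<open>{..-1}\<close>, which the index shift
  turns into \<open>{..0}\<close>; hence each component again starts at \<open>[]\<close>.\<close>

lemma chain_\<omega>:
  assumes "chain k T" "i \<in> {1..k}"
  shows "chain 1 (\<omega> k T i)" "last (\<omega> k T i) = quot k (last T) i"
    and "int i + int k * (chain_perm (\<omega> k T i) j - 1) = chain_perm T (int i + int k * (j - 1))"
    and "balanced k (last T)"
proof -
  interpret chain k T by (rule assms)
  note B = balanced_chain[OF steps nonempty _ assms(2)]
  have bal: "balanced k (hd T)" using hd_Nil balanced_Nil by simp
  show last_bal: "balanced k (last T)" by (rule B(1)[OF bal])
  show last: "last (\<omega> k T i) = quot k (last T) i"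
    using nonempty by (simp add: \<omega>_def last_map)
  have "zeros (quot k [] i) = {j. j - 1 \<in> {..-1}}"
    using quot_zeros(2)[OF balanced_Nil assms(2)] runner_zeros_Nil[OF assms(2)] by simp
  also have "\<dots> = zeros []" unfolding zeros_Nil by auto
  finally have "quot k [] i = []"
    using zeros_inject[OF quot_zeros(1)[OF balanced_Nil assms(2)]] by (simp add: is_partition_def)
  then have "hd (\<omega> k T i) = []" using nonempty hd_Nil by (simp add: \<omega>_def hd_map)
  then show "chain 1 (\<omega> k T i)"
    using B(2)[OF bal] nonempty quot_zeros(1)[OF last_bal assms(2)] last
    unfolding chain_def \<omega>_def by (simp add: successively_remdups_adjI)
  show "int i + int k * (chain_perm (\<omega> k T i) j - 1) = chain_perm T (int i + int k * (j - 1))"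
    unfolding \<omega>_def chain_perm_remdups_adj by (rule B(3)[OF bal])
qed

text \<open>One block is split off at a time: \<rho> is the copy of \<open>p i\<close> on the image
  of \<open>e i\<close>, and composing \<pi> with its inverse makes it agree with
  \<open>\<pi>'\<close> there. The other blocks are disjoint from this image and stay as they
  are.\<close>

lemma sign_glue:
  assumes "finite I" "finite B" "\<pi>' permutes B" "\<pi> permutes B"
    and "\<And>i. i \<in> I \<Longrightarrow> finite (A i)" "\<And>i. i \<in> I \<Longrightarrow> p i permutes A i"
    and "\<And>i. i \<in> I \<Longrightarrow> inj_on (e i) (A i)" "\<And>i. i \<in> I \<Longrightarrow> e i ` A i \<subseteq> B"
    and "\<And>i j. i \<in> I \<Longrightarrow> j \<in> I \<Longrightarrow> i \<noteq> j \<Longrightarrow> e i ` A i \<inter> e j ` A j = {}"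
    and "\<And>i q. i \<in> I \<Longrightarrow> q \<in> A i \<Longrightarrow> \<pi> (e i q) = \<pi>' (e i (p i q))"
    and "\<And>x. x \<in> B \<Longrightarrow> x \<notin> (\<Union>i\<in>I. e i ` A i) \<Longrightarrow> \<pi> x = \<pi>' x"
  shows "sign \<pi> = sign \<pi>' * (\<Prod>i\<in>I. sign (p i))"
  using assms(1,4-)
proof (induction I arbitrary: \<pi> rule: finite_induct)
  case empty
  have "\<pi> x = \<pi>' x" for x
    using empty(8)[of x] permutes_not_in[OF assms(3), of x] permutes_not_in[OF empty(1), of x]
    by (cases "x \<in> B") auto
  then have "\<pi> = \<pi>'" by auto
  then show ?case by simp
next
  case (insert i I)
  note fin = insert.prems(2) and perm = insert.prems(3) and inj = insert.prems(4)
    and sub = insert.prems(5) and disj = insert.prems(6)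
  define \<rho> where "\<rho> = map_permutation (A i) (e i) (p i)"
  have \<rho>: "\<rho> permutes e i ` A i"
    unfolding \<rho>_def
    by (rule map_permutation_permutes[OF inj_on_imp_bij_betw[OF inj] perm]) simp_all
  then have \<rho>B: "\<rho> permutes B" using sub[of i] by (auto intro: permutes_subset)
  have \<rho>_e: "\<rho> (e i q) = e i (p i q)" if "q \<in> A i" for q
    unfolding \<rho>_def by (rule map_permutation_apply[OF inj that]) simp
  define \<pi>\<^sub>1 where "\<pi>\<^sub>1 = \<pi> \<circ> inv \<rho>"
  have \<pi>\<^sub>1_e: "\<pi>\<^sub>1 x = \<pi>' x" if "x \<in> e i ` A i" for x
  proof -
    have "inv \<rho> x \<in> e i ` A i" using that permutes_inv[OF \<rho>] by (simp add: permutes_in_image)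
    then obtain q where q: "q \<in> A i" "inv \<rho> x = e i q" by auto
    then have "x = e i (p i q)" using \<rho>_e[OF q(1)] permutes_inverses(1)[OF \<rho>, of x] by simp
    then show ?thesis using q insert.prems(7)[of i q] by (simp add: \<pi>\<^sub>1_def)
  qed
  have \<pi>\<^sub>1_other: "\<pi>\<^sub>1 x = \<pi> x" if "x \<notin> e i ` A i" for x
    using permutes_not_in[OF permutes_inv[OF \<rho>] that] by (simp add: \<pi>\<^sub>1_def)
  have perm1: "\<pi>\<^sub>1 permutes B"
    unfolding \<pi>\<^sub>1_def by (rule permutes_compose[OF permutes_inv[OF \<rho>B] insert.prems(1)])
  have "sign \<pi>\<^sub>1 = sign \<pi>' * (\<Prod>i\<in>I. sign (p i))"
  proof (rule insert.IH[OF perm1])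
    fix j q assume jq: "j \<in> I" "q \<in> A j"
    then have "e j q \<notin> e i ` A i" using disj[of i j] insert.hyps(2) by blast
    then show "\<pi>\<^sub>1 (e j q) = \<pi>' (e j (p j q))"
      using \<pi>\<^sub>1_other insert.prems(7)[of j q] jq by simp
  next
    fix x assume x: "x \<in> B" "x \<notin> (\<Union>j\<in>I. e j ` A j)"
    show "\<pi>\<^sub>1 x = \<pi>' x"
      using \<pi>\<^sub>1_e \<pi>\<^sub>1_other insert.prems(8)[OF x(1)] x(2) by (cases "x \<in> e i ` A i") auto
  qed (use fin perm inj sub disj in auto)
  moreover have "sign \<pi> = sign \<pi>\<^sub>1 * sign \<rho>"
  proof -
    have "\<pi> = \<pi>\<^sub>1 \<circ> \<rho>"
      by (simp add: \<pi>\<^sub>1_def comp_assoc permutes_inv_o(2)[OF \<rho>])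
    moreover have "permutation \<pi>\<^sub>1" "permutation \<rho>"
      using perm1 \<rho>B assms(2) by (auto simp: permutation_permutes)
    ultimately show ?thesis using sign_compose by metis
  qed
  moreover have "sign \<rho> = sign (p i)"
    unfolding \<rho>_def by (rule sign_map_permutation[OF inj perm fin]) simp_all
  ultimately show ?case using insert.hyps by simp
qed

lemma sign_zero_perm_quot:
  assumes "chain k T" "chain k T'" "last T' = last T" and k: "0 < k"
    and T': "successively (\<lambda>\<rho> \<nu>. is_rim_hook k \<nu> \<rho>) T'"
  shows "sign (zero_perm T) = sign (zero_perm T') * (\<Prod>i = 1..k. sign (zero_perm (\<omega> k T i)))"
proof -
  interpret T: chain k T by (rule assms)
  interpret T': chain k T' by (rule assms)
  define \<nu> where "\<nu> = last T"
  define l where "l = (\<lambda>i. length (quot k \<nu> i))"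
  text \<open>\<open>e i q\<close> is the place, among the zeros \<open>-\<ell> + 1, \<dots>, 0\<close> of the empty partition, of the
    zero which is the \<open>q\<close>-th labelled one on runner \<open>i\<close>.\<close>
  define e where "e = (\<lambda>i q. nat (int i + int k * (int q - int (l i) - 1) + int (length \<nu>)))"
  have \<nu>: "last T = \<nu>" "last T' = \<nu>" using assms(3) \<nu>_def by auto
  note C = chain_\<omega>[OF assms(1)] and C' = chain_\<omega>[OF assms(2)]
  have last: "last (\<omega> k T i) = quot k \<nu> i" "last (\<omega> k T' i) = quot k \<nu> i" if "i \<in> {1..k}" for i
    using C(2)[OF that] C'(2)[OF that] \<nu> by auto
  have e: "int (e i q) = int i + int k * (int q - int (l i) - 1) + int (length \<nu>)"
      "e i q \<in> {1..length \<nu>}" if i: "i \<in> {1..k}" and q: "q \<in> {1..l i}" for i q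
  proof -
    have bal: "balanced k \<nu>" using C(4)[OF i] \<nu> by simp
    have "quot k \<nu> i \<noteq> []" using q by (auto simp: l_def)
    \<comment> \<open>This one of the component sits, on the runner, at the very place assigned to
      \<open>q = 1\<close>. As a one of \<nu> it lies right of the ray up to
      \<open>- length \<nu>\<close>, and so does the whole block.\<close>
    then have "1 - int (l i) \<notin> zeros (quot k \<nu> i)"
      using length_not_in_zeros[OF quot_zeros(1)[OF bal i]] by (simp add: l_def)
    then have "int i + int k * (- int (l i)) \<notin> zeros \<nu>"
      using quot_zeros(2)[OF bal i] by (simp add: runner_def)
    then have "- int (length \<nu>) < int i + int k * (- int (l i))"
      using zeros_split[of \<nu>] by (metis UnI1 atMost_iff not_le)
    also have "\<dots> \<le> int i + int k * (int q - int (l i) - 1)"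
      using q by (intro add_left_mono mult_left_mono) auto
    finally have low: "- int (length \<nu>) < int i + int k * (int q - int (l i) - 1)" .
    then show *: "int (e i q) = int i + int k * (int q - int (l i) - 1) + int (length \<nu>)"
      by (simp add: e_def)
    \<comment> \<open>The top of the block, \<open>q = l i\<close>, gives the place
      \<open>i - k\<close>, which is nonpositive.\<close>
    have "int k * (int q - int (l i) - 1) \<le> int k * (-1)"
      using q by (intro mult_left_mono) auto
    then have "int i + int k * (int q - int (l i) - 1) \<le> 0" using i by simp
    then have "1 \<le> int (e i q)" "int (e i q) \<le> int (length \<nu>)" using * low by linarith+
    then show "e i q \<in> {1..length \<nu>}" by simp
  qed
  \<comment> \<open>Distances in the component become multiples of \<open>k\<close> in the shape, so
    monotonicity on residue classes makes the component of \<open>T'\<close> increasing.\<close>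
  have id': "zero_perm (\<omega> k T' i) q = q" if i: "i \<in> {1..k}" for i q
  proof (rule chain.zero_perm_mono[OF C'(1)[OF i]])
    fix x y :: int assume xy: "x < y" "y \<le> 0"
    have mem: "int i + int k * (z - 1) \<in> zeros (hd T')" if "z \<le> 0" for z
    proof -
      have "int k * (z - 1) \<le> int k * (-1)" using that by (intro mult_left_mono) auto
      then show ?thesis using i T'.hd_Nil zeros_Nil by simp
    qed
    have "(int i + int k * (y - 1)) - (int i + int k * (x - 1)) = int k * (y - x)"
      by (simp add: algebra_simps)
    then have "chain_perm T' (int i + int k * (x - 1)) < chain_perm T' (int i + int k * (y - 1))"
      using xy k by (intro chain_perm_mono_on_class[OF T' mem mem]) auto
    then show "chain_perm (\<omega> k T' i) x < chain_perm (\<omega> k T' i) y"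
      unfolding C'(3)[OF i, symmetric] using k by simp
  qed
  have perm: "zero_perm (\<omega> k T i) permutes {1..l i}" if "i \<in> {1..k}" for i
    using chain.zero_perm_permutes[OF C(1)[OF that]] last[OF that] by (simp add: l_def)
  show ?thesis
  proof (rule sign_glue[where B = "{1..length \<nu>}" and A = "\<lambda>i. {1..l i}" and e = e])
    show "zero_perm T' permutes {1..length \<nu>}" "zero_perm T permutes {1..length \<nu>}"
      using T.zero_perm_permutes T'.zero_perm_permutes \<nu> by simp_all
    fix i assume i: "i \<in> {1..k}"
    show "zero_perm (\<omega> k T i) permutes {1..l i}" by (rule perm[OF i])
    show "e i ` {1..l i} \<subseteq> {1..length \<nu>}" using e(2)[OF i] by blast
    show "inj_on (e i) {1..l i}"
    proof (rule inj_onI)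
      fix q q' assume q: "q \<in> {1..l i}" "q' \<in> {1..l i}" and "e i q = e i q'"
      then have "int (e i q) = int (e i q')" by simp
      then have "int k * (int q - int (l i) - 1) = int k * (int q' - int (l i) - 1)"
        unfolding e(1)[OF i q(1)] e(1)[OF i q(2)] by simp
      then show "q = q'" using k by auto
    qed
    show "e i ` {1..l i} \<inter> e j ` {1..l j} = {}" if j: "j \<in> {1..k}" and ne: "i \<noteq> j" for j
    proof -
      have "e i q \<noteq> e j q'" if "q \<in> {1..l i}" "q' \<in> {1..l j}" for q q'
      proof
        assume "e i q = e j q'"
        then have "int i - int j = int k * ((int q' - int (l j)) - (int q - int (l i)))"
          using e(1)[OF i that(1)] e(1)[OF j that(2)] by (simp add: algebra_simps)
        then have "int k dvd int i - int j" by simp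
        moreover have "\<bar>int i - int j\<bar> < int k" using i j by auto
        ultimately show False using ne dvd_imp_le_int[of "int i - int j" "int k"] by auto
      qed
      then show ?thesis by blast
    qed
    fix q assume q: "q \<in> {1..l i}"
    define q' where "q' = zero_perm (\<omega> k T i) q"
    have q': "q' \<in> {1..l i}" unfolding q'_def using q by (simp only: permutes_in_image[OF perm[OF i]])
    \<comment> \<open>The zero permutation of the component of \<open>T'\<close> fixes
      \<open>q'\<close>, so it takes at \<open>q'\<close> the value that the one of \<open>T\<close>
      takes at \<open>q\<close>; equal values mean equal positions.\<close>
    have "chain_perm (\<omega> k T i) (int q - int (l i)) = chain_perm (\<omega> k T' i) (int q' - int (l i))"
      using zero_perm_eq_iff[OF C(1)[OF i] C'(1)[OF i], of q q'] id'[OF i] last[OF i] q q'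
      by (simp add: l_def q'_def)
    then have "chain_perm T (int i + int k * (int q - int (l i) - 1)) =
        chain_perm T' (int i + int k * (int q' - int (l i) - 1))"
      unfolding C(3)[OF i, symmetric] C'(3)[OF i, symmetric] by simp
    then show "zero_perm T (e i q) = zero_perm T' (e i (zero_perm (\<omega> k T i) q))"
      using zero_perm_eq_iff[OF assms(1,2,3), of "e i q" "e i q'"] e[OF i q] e[OF i q'] \<nu>
      by (simp add: q'_def)
  next
    fix x assume x: "x \<in> {1..length \<nu>}" and notin: "x \<notin> (\<Union>i\<in>{1..k}. e i ` {1..l i})"
    let ?y = "int x - int (length \<nu>)"
    show "zero_perm T x = zero_perm T' x"
    proof -
      \<comment> \<open>Representing residues by 1 to \<open>k\<close> requires the shift by one
        before the division.\<close>
      define i where "i = Suc (nat ((?y - 1) mod int k))"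
      define j where "j = (?y - 1) div int k + 1"
      have y: "?y = int i + int k * (j - 1)"
        unfolding i_def j_def using k by simp
      have "nat ((?y - 1) mod int k) < k" using k by (simp add: nat_less_iff)
      then have i: "i \<in> {1..k}" by (simp add: i_def)
      have "?y - 1 < 0" using x by simp
      then have "(?y - 1) div int k < 0" using k by (intro div_neg_pos_less0) simp_all
      then have "j \<le> 0" unfolding j_def by simp
      \<comment> \<open>A larger \<open>j\<close> would put \<open>x\<close> into the block of
        runner \<open>i\<close>. What remains lies in the ray fixed by the components of both
        tableaux.\<close>
      have j: "j \<le> - int (l i)"
      proof (rule ccontr)
        assume low: "\<not> ?thesis"
        define q where "q = nat (j + int (l i))"
        have q: "int q = j + int (l i)" "q \<in> {1..l i}"
          using low \<open>j \<le> 0\<close> unfolding q_def by auto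
        have "int (e i q) = int x" unfolding e(1)[OF i q(2)] q(1) using y by simp
        then have "x \<in> e i ` {1..l i}" using q(2) by (intro image_eqI[of _ _ q]) simp_all
        then show False using notin i by (simp only: UN_iff) blast
      qed
      have "chain_perm (\<omega> k T i) j = j" "chain_perm (\<omega> k T' i) j = j"
        using chain.chain_perm_fixes_low[OF C(1)[OF i]] chain.chain_perm_fixes_low[OF C'(1)[OF i]]
          last[OF i] j by (simp_all add: l_def)
      then have "chain_perm T ?y = chain_perm T' ?y"
        unfolding y C(3)[OF i, symmetric] C'(3)[OF i, symmetric] by simp
      then show ?thesis using zero_perm_eq_iff[OF assms(1,2,3), of x x] x \<nu> by simp
    qed
  qed simp_all
qed

section \<open>Rim hook tableaux as chains, and the sign formula\<close>

lemma RHT_chain: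
  assumes "T \<in> RHT \<nu> \<mu>" "\<forall>m\<in>set \<mu>. k dvd m"
  shows "chain k T" "last T = \<nu>"
proof -
  have T: "length T = Suc (length \<mu>)" "\<forall>\<rho>\<in>set T. is_partition \<rho>" "hd T = []" "last T = \<nu>"
    and step: "\<And>j. j < length \<mu> \<Longrightarrow> if \<mu> ! j = 0 then T ! Suc j = T ! j
                   else is_rim_hook (\<mu> ! j) (T ! Suc j) (T ! j)"
    using assms(1) by (auto simp: RHT_def)
  have "T \<noteq> []" using T(1) by auto
  moreover have "hook_step k (T ! j) (T ! Suc j)" if "j < length \<mu>" for j
  proof (cases "\<mu> ! j = 0")
    case True
    then show ?thesis using step[OF that] T(1,2) that by (simp add: hook_step_def)
  next
    case False
    then show ?thesis using step[OF that] assms(2) that rim_hook_imp_hook_step by simp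
  qed
  ultimately show "chain k T" "last T = \<nu>"
    using T last_in_set[of T] by (auto simp: chain_def successively_conv_nth)
qed

theorem theorem4p5:
  fixes k p :: nat and lam :: "nat list"
  assumes "k \<ge> 2"
    and "is_partition lam"
    and "k_core k lam = []"
    and "p = sum_list lam div k"
  shows "(\<exists>T'. T' \<in> RHT lam (replicate p k)) \<and>
    (\<forall>\<mu> T T'. is_partition \<mu> \<longrightarrow> sum_list \<mu> = p \<longrightarrow>
       T \<in> RHT lam (map (\<lambda>m. k * m) \<mu>) \<longrightarrow>
       T' \<in> RHT lam (replicate p k) \<longrightarrow>
       sign (zero_perm T) =
         sign (zero_perm T') * (\<Prod>i = 1..k. sign (zero_perm (\<omega> k T i))))"
proof (intro conjI allI impI)
  show "\<exists>T'. T' \<in> RHT lam (replicate p k)"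
    using ex_RHT_replicate[OF assms(2,3)] assms(1,4) by auto
next
  fix \<mu> T T'
  assume T: "T \<in> RHT lam (map (\<lambda>m. k * m) \<mu>)" and T': "T' \<in> RHT lam (replicate p k)"
  \<comment> \<open>As \<open>k\<close> is positive, the alternative for entries 0 never occurs in
    \<open>T'\<close>: every step is a hook of exactly \<open>k\<close> boxes, as monotonicity on
    residue classes requires.\<close>
  have "successively (\<lambda>\<rho> \<nu>. is_rim_hook k \<nu> \<rho>) T'"
    using T' assms(1) by (auto simp: RHT_def successively_conv_nth)
  moreover have "chain k T" "last T = lam" by (rule RHT_chain[OF T]; auto)+
  moreover have "chain k T'" "last T' = lam" by (rule RHT_chain[OF T']; auto)+
  ultimately show "sign (zero_perm T) =
      sign (zero_perm T') * (\<Prod>i = 1..k. sign (zero_perm (\<omega> k T i)))"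
    using assms(1) by (intro sign_zero_perm_quot) auto
qed

end
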